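(* Let $\tau>0$ and $\alpha>0$, and for $k\ge0$ define $$\Phi_{S,k}(g,x,y,\eta)=\left\{\begin{bmatrix}(1-\eta)x+\eta\,\mathrm{prox}_{\mathcal X}\big(x-\alpha(y-\tau\eta(y-g))\big)\\ y-\tau\eta(y-g)\end{bmatrix}\right\},\qquad g\in\mathbb R^n,\ x\in\mathcal X,\ y\in\mathbb R^n,\ \eta\in\mathbb R.$$ Then the sequence of mappings $\{\Phi_{S,k}\}$ represents an embeddable stochastic subgradient method.
   Context: $\mathcal X\subseteq\mathbb R^n$ is a closed convex set, $\mathcal N_{\mathcal X}(x)$ its normal cone at $x\in\mathcal X$, $\mathrm{prox}_{\mathcal X}(x)=\arg\min_{z\in\mathcal X}\|z-x\|^2$; $\mathrm{dist}$ between a set and a point is the infimum of the distances from the point to the elements of the set. (The method $(x_{k+1},y_{k+1})\in\Phi_{S,k}(g_k,x_k,y_k,\eta_k)$ is proximal SGD with momentum: $y_{k+1}=y_k-\tau\eta_k(y_k-g_k)$, $x_{k+1}=(1-\eta_k)x_k+\eta_k\mathrm{prox}_{\mathcal X}(x_k-\alpha y_{k+1})$, with primal variable $x$ and auxiliary variable $y$.) Conservative field: for a locally Lipschitz $h:\mathbb R^n\to\mathbb R$, a set-valued $\mathcal D_h:\mathbb R^n\rightrightarrows\mathbb R^{n}$ that is nonempty-valued, locally bounded, graph-closed, and such that for every absolutely continuous curve $\gamma:\mathbb R_+\to\mathbb R^n$, for almost every $t$, $\frac{d(h\circ\gamma)}{dt}(t)=\langle d,\dot\gamma(t)\rangle$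 for all $d\in\mathcal D_h(\gamma(t))$. $h$ is path-differentiable if it is locally Lipschitz and admits a conservative field. $\delta$-expansion: $\mathcal D^\delta(x)=\{w:\exists z,\ \|z-x\|\le\delta,\ \mathrm{dist}(w,\mathcal D(z))\le\delta\}$. For positive stepsizes $\{\eta_k\}$: $\sigma_0=0$, $\sigma_i=\sum_{k=0}^{i-1}\eta_k$, $\Lambda(t)=\sup\{k\ge0:\sigma_k\le t\}$. Embeddable stochastic subgradient method (auxiliary variable $y\in\mathbb R^q$; here $q=n$): set-valued mappings $\Phi_k:\mathbb R^n\times\mathcal X\times\mathbb R^q\times\mathbb R\rightrightarrows\mathcal X\times\mathbb R^q$, $k\ge0$, represent an embeddable stochastic subgradient method if (i) there is a locally bounded $T_\Phi:\mathbb R^n\times\mathcal X\times\mathbb R^q\to\mathbb R_+$ such that $\sup_{k\ge0}\mathrm{dist}\big(\Phi_k(g,x,y,\eta),(x,y)\big)\le\eta\,T_\Phi(g,x,y)$ for all $(g,x,y,\eta)\in\mathbb R^n\times\mathcal X\times\mathbb R^q\times\mathbb R_+$; and (ii) whenever $h:\mathbb R^n\to\mathbb R$ is path-differentiable with convex-valued conservative field $\mathcal D_h$, and $\{(x_k,y_k)\}$ satisfies $(x_{k+1},y_{k+1})\in\Phi_k(g_k,x_k,y_k,\eta_k)$ for all $k\geq 0$, with: $\{h(x):x\in\mathcal X,0\in\mathcal D_h(x)+\mathcal N_{\mathcal X}(x)\}$ having empty interior in $\mathbb R$; $\{(x_k,y_k)\}$ uniformly bounded in $\mathcal X\times\mathbb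 R^q$; $g_k\in\mathcal D_h^{\delta_k}(x_k)+\xi_{k+1}$ for some nonnegative $\delta_k\to0$ and some $\{\xi_k\}\subset\mathbb R^n$; and $\eta_k>0$, $\eta_k\to0$, $\sum_k\eta_k=+\infty$, $\sup_k\|\xi_k\|<\infty$, $\lim_{i\to\infty}\sup_{i\le j\le\Lambda(\sigma_i+T)}\|\sum_{k=i}^j\eta_k\xi_{k+1}\|=0$ for every $T>0$; then every cluster point of $\{x_k\}$ lies in $\{x\in\mathcal X:0\in\mathcal D_h(x)+\mathcal N_{\mathcal X}(x)\}$ and $\{h(x_k)\}$ converges.
   Formalization: Condition (i) fails for all η≥0 when X is unbounded (displacement of order η²), so it is stated for η in [0,η_max], every η_max, and for all η≥0 if X is bounded; values in X×R^n are claimed only for η in [0,1], since outside it the x-part can leave X. *)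

theory Defs
  imports "HOL-Analysis.Analysis"
begin

section \<open>Convex geometry\<close>

text \<open>Only meaningful at points of \<open>X\<close>.\<close>
definition normal_cone :: "(real^'n) set \<Rightarrow> real^'n \<Rightarrow> (real^'n) set" where
  "normal_cone X x = {v. \<forall>z\<in>X. v \<bullet> (z - x) \<le> 0}"

definition prox :: "(real^'n) set \<Rightarrow> real^'n \<Rightarrow> real^'n" where
  "prox X x = arg_min_on (\<lambda>z. (norm (z - x))\<^sup>2) X"

section \<open>Conservative fields\<close>

definition locally_lipschitz :: "(real^'n \<Rightarrow> real) \<Rightarrow> bool" where
  "locally_lipschitz h \<longleftrightarrow> (\<forall>x. \<exists>u>0. \<exists>L. L-lipschitz_on (ball x u) h)"

text \<open>
  Epsilon-delta absolute continuity on \<open>{a..b}\<close>; \<open>D division_of U\<close> says that \<open>D\<close> is a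
  finite family of non-overlapping compact intervals with union \<open>U\<close>.
\<close>
definition abs_continuous_on_Icc :: "real \<Rightarrow> real \<Rightarrow> (real \<Rightarrow> 'a::real_normed_vector) \<Rightarrow> bool" where
  "abs_continuous_on_Icc a b f \<longleftrightarrow>
     (\<forall>\<epsilon>>0. \<exists>\<delta>>0. \<forall>D U. D division_of U \<and> U \<subseteq> {a..b} \<and> (\<Sum>K\<in>D. Sup K - Inf K) < \<delta>
        \<longrightarrow> (\<Sum>K\<in>D. norm (f (Sup K) - f (Inf K))) < \<epsilon>)"

text \<open>
  A curve on \<open>[0,\<infinity>)\<close> is absolutely continuous if it is so on every compact subinterval;
  its values at negative times are irrelevant.
\<close>
definition abs_continuous_curve :: "(real \<Rightarrow> real^'n) \<Rightarrow> bool" where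
  "abs_continuous_curve \<gamma> \<longleftrightarrow> (\<forall>b\<ge>0. abs_continuous_on_Icc 0 b \<gamma>)"

text \<open>
  Absolutely continuous curves are differentiable almost everywhere, so asserting the
  existence of the velocity \<open>v\<close> below adds nothing.
\<close>
definition conservative_field :: "(real^'n \<Rightarrow> real) \<Rightarrow> (real^'n \<Rightarrow> (real^'n) set) \<Rightarrow> bool" where
  "conservative_field h D \<longleftrightarrow>
     locally_lipschitz h \<and>
     (\<forall>x. D x \<noteq> {}) \<and>
     (\<forall>x. \<exists>U. open U \<and> x \<in> U \<and> bounded (\<Union>z\<in>U. D z)) \<and>
     closed {(x, d). d \<in> D x} \<and>
     (\<forall>\<gamma>. abs_continuous_curve \<gamma> \<longrightarrow>
        (AE t in lebesgue_on {0..}. \<exists>v. (\<gamma> has_vector_derivative v) (at t) \<and>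
           (\<forall>d\<in>D (\<gamma> t). ((h \<circ> \<gamma>) has_real_derivative (d \<bullet> v)) (at t))))"

definition path_differentiable :: "(real^'n \<Rightarrow> real) \<Rightarrow> bool" where
  "path_differentiable h \<longleftrightarrow> locally_lipschitz h \<and> (\<exists>D. conservative_field h D)"

text \<open>
  The distance to the empty set is \<open>+\<infinity>\<close>, whereas \<^term>\<open>infdist w {} = 0\<close>; hence the
  explicit non-emptiness, here and in \<open>embeddable\<close>.
\<close>
definition expansion :: "(real^'n \<Rightarrow> (real^'n) set) \<Rightarrow> real \<Rightarrow> real^'n \<Rightarrow> (real^'n) set" where
  "expansion D \<delta> x = {w. \<exists>z. norm (z - x) \<le> \<delta> \<and> D z \<noteq> {} \<and> infdist w (D z) \<le> \<delta>}"

definition crit :: "(real^'n) set \<Rightarrow> (real^'n \<Rightarrow> (real^'n) set) \<Rightarrow> (real^'n) set" where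
  "crit X D = {x \<in> X. 0 \<in> {d + v | d v. d \<in> D x \<and> v \<in> normal_cone X x}}"

section \<open>Stepsizes\<close>

definition step_sum :: "(nat \<Rightarrow> real) \<Rightarrow> nat \<Rightarrow> real" where
  "step_sum \<eta> i = (\<Sum>k<i. \<eta> k)"

text \<open>
  The supremum is that of \<^typ>\<open>nat\<close>; the set is finite and non-empty when \<open>t \<ge> 0\<close> and the
  positive stepsizes have a divergent sum.
\<close>
definition step_index :: "(nat \<Rightarrow> real) \<Rightarrow> real \<Rightarrow> nat" where
  "step_index \<eta> t = Sup {k. step_sum \<eta> k \<le> t}"

definition vanishing_noise :: "(nat \<Rightarrow> real) \<Rightarrow> (nat \<Rightarrow> real^'n) \<Rightarrow> bool" where
  "vanishing_noise \<eta> \<xi> \<longleftrightarrow>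
     (\<forall>T>0. (\<lambda>i. SUP j\<in>{i..step_index \<eta> (step_sum \<eta> i + T)}.
                norm (\<Sum>k=i..j. \<eta> k *\<^sub>R \<xi> (Suc k))) \<longlonglongrightarrow> 0)"

section \<open>Embeddable stochastic subgradient methods\<close>

definition cluster_point :: "(nat \<Rightarrow> real^'n) \<Rightarrow> real^'n \<Rightarrow> bool" where
  "cluster_point s p \<longleftrightarrow> (\<exists>r. strict_mono r \<and> (s \<circ> r) \<longlonglongrightarrow> p)"

definition locally_bounded_on :: "'a::topological_space set \<Rightarrow> ('a \<Rightarrow> real) \<Rightarrow> bool" where
  "locally_bounded_on S f \<longleftrightarrow> (\<forall>p\<in>S. \<exists>U. open U \<and> p \<in> U \<and> bounded (f ` (U \<inter> S)))"

text \<open>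
  Condition (i). The set \<open>E\<close> consists of the stepsizes for which the displacement bound is
  required; \<open>E = {0..}\<close> is the condition in its usual form. The bound \<open>T\<close> may depend on \<open>E\<close>,
  but not on the individual stepsize.
\<close>
definition embeddable_displacement ::
    "(real^'n) set \<Rightarrow> real set \<Rightarrow> (nat \<Rightarrow> real^'n \<Rightarrow> real^'n \<Rightarrow> real^'q \<Rightarrow> real \<Rightarrow> ((real^'n) \<times> (real^'q)) set) \<Rightarrow> bool"
  where
  "embeddable_displacement X E \<Phi> \<longleftrightarrow>
     (\<exists>T. locally_bounded_on (UNIV \<times> X \<times> UNIV) T \<and>
        (\<forall>g. \<forall>x\<in>X. \<forall>y. 0 \<le> T (g, x, y)) \<and>
        (\<forall>g. \<forall>x\<in>X. \<forall>y. \<forall>\<eta>\<in>E. \<forall>k.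
            \<Phi> k g x y \<eta> \<noteq> {} \<and> infdist (x, y) (\<Phi> k g x y \<eta>) \<le> \<eta> * T (g, x, y)))"

text \<open>
  Condition (ii). The requirement that the iterates stay in \<open>X\<close> is part of \<open>{(x\<^sub>k, y\<^sub>k)}\<close>
  being a bounded sequence in \<open>X \<times> \<real>\<^sup>q\<close>. The element \<open>\<xi> 0\<close> never enters the recursion.
\<close>
definition embeddable_convergence ::
    "(real^'n) set \<Rightarrow> (nat \<Rightarrow> real^'n \<Rightarrow> real^'n \<Rightarrow> real^'q \<Rightarrow> real \<Rightarrow> ((real^'n) \<times> (real^'q)) set) \<Rightarrow> bool"
  where
  "embeddable_convergence X \<Phi> \<longleftrightarrow>
     (\<forall>h D x y g \<eta> \<delta> \<xi>.
        path_differentiable h \<and> conservative_field h D \<and> (\<forall>z. convex (D z)) \<and>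
        (\<forall>k. (x (Suc k), y (Suc k)) \<in> \<Phi> k (g k) (x k) (y k) (\<eta> k)) \<and>
        interior (h ` crit X D) = {} \<and>
        (\<forall>k. x k \<in> X) \<and> bounded (range (\<lambda>k. (x k, y k))) \<and>
        (\<forall>k. 0 \<le> \<delta> k) \<and> \<delta> \<longlonglongrightarrow> 0 \<and>
        (\<forall>k. g k \<in> {w + \<xi> (Suc k) | w. w \<in> expansion D (\<delta> k) (x k)}) \<and>
        (\<forall>k. 0 < \<eta> k) \<and> \<eta> \<longlonglongrightarrow> 0 \<and> filterlim (step_sum \<eta>) at_top sequentially \<and>
        bounded (range \<xi>) \<and> vanishing_noise \<eta> \<xi>
      \<longrightarrow> (\<forall>p. cluster_point x p \<longrightarrow> p \<in> crit X D) \<and> convergent (\<lambda>k. h (x k)))"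

definition embeddable ::
    "(real^'n) set \<Rightarrow> real set \<Rightarrow> (nat \<Rightarrow> real^'n \<Rightarrow> real^'n \<Rightarrow> real^'q \<Rightarrow> real \<Rightarrow> ((real^'n) \<times> (real^'q)) set) \<Rightarrow> bool"
  where
  "embeddable X E \<Phi> \<longleftrightarrow> embeddable_displacement X E \<Phi> \<and> embeddable_convergence X \<Phi>"

section \<open>Proximal SGD with momentum\<close>

definition Phi_S :: "(real^'n) set \<Rightarrow> real \<Rightarrow> real \<Rightarrow> nat \<Rightarrow> real^'n \<Rightarrow> real^'n \<Rightarrow> real^'n \<Rightarrow> real
    \<Rightarrow> ((real^'n) \<times> (real^'n)) set" where
  "Phi_S X \<tau> \<alpha> k g x y \<eta> =
     {((1 - \<eta>) *\<^sub>R x + \<eta> *\<^sub>R prox X (x - \<alpha> *\<^sub>R (y - (\<tau> * \<eta>) *\<^sub>R (y - g))),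
       y - (\<tau> * \<eta>) *\<^sub>R (y - g))}"

text \<open>
  For unbounded \<open>X\<close>, for instance \<open>X = UNIV\<close>, the displacement of \<open>Phi_S\<close> can grow quadratically in the stepsize, so
  that condition (i) fails if all stepsizes in \<open>[0,\<infinity>)\<close> are admitted.
\<close>
lemma not_embeddable_displacement_Phi_S:
  assumes "0 < \<tau>" "0 < \<alpha>"
  shows "\<not> embeddable_displacement (UNIV :: (real^'n) set) {0..} (Phi_S UNIV \<tau> \<alpha>)"
proof
  assume "embeddable_displacement (UNIV :: (real^'n) set) {0..} (Phi_S UNIV \<tau> \<alpha>)"
  then obtain T :: "(real^'n) \<times> (real^'n) \<times> (real^'n) \<Rightarrow> real" where
    "\<forall>g. \<forall>x\<in>UNIV. \<forall>y. \<forall>\<eta>\<in>{0..}. \<forall>k. Phi_S UNIV \<tau> \<alpha> k g x y \<eta> \<noteq> {} \<and>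
       infdist (x, y) (Phi_S UNIV \<tau> \<alpha> k g x y \<eta>) \<le> \<eta> * T (g, x, y)"
    unfolding embeddable_displacement_def by (elim exE conjE)
  then have T: "infdist (x, y) (Phi_S UNIV \<tau> \<alpha> k g x y \<eta>) \<le> \<eta> * T (g, x, y)"
    if "0 \<le> \<eta>" for g x y \<eta> k
    using that by (meson UNIV_I atLeast_iff)
  have prox: "prox UNIV z = z" for z :: "real^'n"
  proof -
    have "is_arg_min (\<lambda>w. (norm (w - z))\<^sup>2) (\<lambda>w. w \<in> UNIV) (prox UNIV z)"
      unfolding prox_def arg_min_on_def arg_min_def
      by (rule someI[of _ z]) (simp add: is_arg_min_def not_less)
    then have "\<not> (norm (z - z))\<^sup>2 < (norm (prox UNIV z - z))\<^sup>2"
      unfolding is_arg_min_def by blast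
    then show ?thesis by simp
  qed
  obtain g :: "real^'n" where g: "norm g = 1"
    using vector_choose_size[of 1] by auto
  define t where "t = (\<bar>T (g, 0, 0)\<bar> + 1) / (\<alpha> * \<tau>)"
  have t: "0 < t" using assms by (simp add: t_def)
  have "t * (\<alpha> * \<tau> * t) = dist (0 :: real^'n) (- (t *\<^sub>R \<alpha> *\<^sub>R (\<tau> * t) *\<^sub>R g))"
    using assms t g by (simp add: dist_norm)
  also have "\<dots> \<le> dist (0, 0) (- (t *\<^sub>R \<alpha> *\<^sub>R (\<tau> * t) *\<^sub>R g), (\<tau> * t) *\<^sub>R g)"
    using dist_fst_le[of "(0, 0)" "(- (t *\<^sub>R \<alpha> *\<^sub>R (\<tau> * t) *\<^sub>R g), (\<tau> * t) *\<^sub>R g)"] by simp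
  also have "\<dots> = infdist (0, 0) (Phi_S UNIV \<tau> \<alpha> 0 g 0 0 t)"
    by (simp add: Phi_S_def prox)
  also have "\<dots> \<le> t * T (g, 0, 0)" using T t by simp
  finally have "\<alpha> * \<tau> * t \<le> T (g, 0, 0)" using t by simp
  moreover have "\<alpha> * \<tau> * t = \<bar>T (g, 0, 0)\<bar> + 1" using assms by (simp add: t_def)
  ultimately show False by linarith
qed

end

theory Submission
  imports Defs "HOL-Complex_Analysis.Great_Picard"
begin

hide_const (open) Polynomial.content

text \<open>
  Why the iterates converge. On the time scale of the step sums, the method is a noisy Euler
  scheme for the differential inclusion
  \<open>x' = prox(x - \<alpha> y) - x\<close>, \<open>y' \<in> - \<tau> (y - D x)\<close>.
  Along its solutions the function
  \<open>V (x, y) = h x - m (x, y) / \<tau>\<close> with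
  \<open>m (x, y) = min {\<langle>y, z - x\<rangle> + \<parallel>z - x\<parallel>\<^sup>2 / (2 \<alpha>) | z \<in> X}\<close>
  decreases. Indeed \<open>d = y + y' / \<tau>\<close> lies in \<open>D x\<close>, so that the chain rule of the conservative
  field gives \<open>(h \<circ> x)' = \<langle>d, x'\<rangle>\<close>, the gradient of \<open>m\<close> is known explicitly, and the optimality
  condition of the projection leaves \<open>V' \<le> - \<parallel>x'\<parallel>\<^sup>2 / \<alpha>\<close>
  (\<open>V_derivative\<close>, \<open>flow_decrease\<close>).

  \<open>V\<close> is only a weak Lyapunov function: it is constant as long as \<open>x\<close> rests, which can happen at a
  noncritical point \<open>x\<close> while \<open>- y\<close> lies in the normal cone. But then \<open>y\<close> moves towards \<open>D x\<close>,
  which a hyperplane separates from the set of such \<open>y\<close>; since \<open>y\<close> stays in a fixed ball, it must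
  leave the cone before a time fixed by \<open>x\<close> and the ball (\<open>stationary_flow_time_bound\<close>). Hence \<open>V\<close>
  decreases strictly over a suitable time span from each point outside the set of equilibria, where
  \<open>x\<close> is critical and \<open>x' = 0\<close> (\<open>flow_strict_decrease\<close>).

  This weak decrease is enough. Windows of fixed length in the rescaled iterates have uniform limits
  that solve the inclusion (\<open>limit_curve\<close>). If \<open>V\<close> did not converge along the iterates, it would
  rise infinitely often from a level \<open>c\<close> to a higher one. As the values of \<open>V\<close> at equilibria are
  values of \<open>h\<close> at critical points and have empty interior, \<open>c\<close> can be chosen outside them; a limit
  curve from the starting points of these rises then begins off the equilibria and falls below \<open>c\<close>,
  although the iterates stay above. The same argument shows that every cluster point is an equilibrium
  (\<open>lyapunov_convergence\<close>). There \<open>V = h\<close>, so \<open>h\<close> converges along the iterates too.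

  The displacement condition is the nonexpansiveness of the projection. For bounded \<open>X\<close> the
  diameter bounds the first component of the displacement without reference to the stepsize.
\<close>

section \<open>Calculus of pointwise Lipschitz functions\<close>

text \<open>
  This pointwise Lipschitz condition holds for locally Lipschitz and for differentiable functions
  and passes to sums and compositions, so that it covers \<open>V\<close> along a Lipschitz curve; it still
  suffices for the fundamental theorem below.
\<close>

definition calm_at :: "('a::metric_space \<Rightarrow> 'b::metric_space) \<Rightarrow> 'a \<Rightarrow> bool" where
  "calm_at f x \<longleftrightarrow> (\<exists>L. \<forall>\<^sub>F y in nhds x. dist (f y) (f x) \<le> L * dist y x)"

lemma calm_at_pos:
  assumes "calm_at f x"
  obtains L where "0 < L" "\<forall>\<^sub>F y in nhds x. dist (f y) (f x) \<le> L * dist y x"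
proof -
  obtain L where L: "\<forall>\<^sub>F y in nhds x. dist (f y) (f x) \<le> L * dist y x"
    using assms by (auto simp: calm_at_def)
  have "\<forall>\<^sub>F y in nhds x. dist (f y) (f x) \<le> (max L 1) * dist y x"
    using L by eventually_elim (meson max.cobounded1 mult_right_mono order_trans zero_le_dist)
  then show ?thesis using that[of "max L 1"] by simp
qed

lemma calm_at_tendsto:
  assumes "calm_at f x"
  shows "(f \<longlongrightarrow> f x) (nhds x)"
proof -
  obtain L where L: "0 < L" "\<forall>\<^sub>F y in nhds x. dist (f y) (f x) \<le> L * dist y x"
    using calm_at_pos[OF assms] .
  show ?thesis
    unfolding tendsto_iff
  proof (intro allI impI)
    fix e :: real assume "0 < e"
    then have "\<forall>\<^sub>F y in nhds x. dist y x < e / L"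
      using L(1) by (auto simp: eventually_nhds_metric intro!: exI[of _ "e / L"])
    with L(2) show "\<forall>\<^sub>F y in nhds x. dist (f y) (f x) < e"
    proof eventually_elim
      case (elim y)
      then have "L * dist y x < e" using L(1) by (simp add: field_simps)
      with elim show ?case by simp
    qed
  qed
qed

lemma calm_at_compose:
  assumes f: "calm_at f x" and g: "calm_at g (f x)"
  shows "calm_at (\<lambda>y. g (f y)) x"
proof -
  obtain L where L: "0 < L" "\<forall>\<^sub>F y in nhds x. dist (f y) (f x) \<le> L * dist y x"
    using calm_at_pos[OF f] .
  obtain M where M: "0 < M" "\<forall>\<^sub>F y in nhds (f x). dist (g y) (g (f x)) \<le> M * dist y (f x)"
    using calm_at_pos[OF g] .
  have "\<forall>\<^sub>F y in nhds x. dist (g (f y)) (g (f x)) \<le> M * dist (f y) (f x)"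
    using M(2) calm_at_tendsto[OF f] by (rule eventually_compose_filterlim)
  with L(2) have "\<forall>\<^sub>F y in nhds x. dist (g (f y)) (g (f x)) \<le> (M * L) * dist y x"
  proof eventually_elim
    case (elim y)
    have "M * dist (f y) (f x) \<le> M * (L * dist y x)" using elim M(1) by (intro mult_left_mono) auto
    with elim show ?case by (simp add: mult.assoc)
  qed
  then show ?thesis unfolding calm_at_def by blast
qed

lemma calm_at_add:
  fixes f g :: "'a::metric_space \<Rightarrow> 'b::real_normed_vector"
  assumes "calm_at f x" "calm_at g x"
  shows "calm_at (\<lambda>y. f y + g y) x"
proof -
  obtain L M where "\<forall>\<^sub>F y in nhds x. dist (f y) (f x) \<le> L * dist y x" "\<forall>\<^sub>F y in nhds x. dist (g y) (g x) \<le> M * dist y x"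
    using assms by (auto simp: calm_at_def)
  then have "\<forall>\<^sub>F y in nhds x. dist (f y + g y) (f x + g x) \<le> (L + M) * dist y x"
  proof eventually_elim
    case (elim y)
    then show ?case using dist_triangle_add[of "f y" "g y" "f x" "g x"] by (simp add: distrib_right)
  qed
  then show ?thesis unfolding calm_at_def by (rule exI[of _ "L + M"])
qed

lemma calm_at_lipschitz: "L-lipschitz_on S f \<Longrightarrow> open S \<Longrightarrow> x \<in> S \<Longrightarrow> calm_at f x"
  unfolding calm_at_def eventually_nhds by (intro exI[of _ L] exI[of _ S]) (auto dest: lipschitz_onD)

lemma calm_at_has_derivative:
  assumes "(f has_derivative f') (at x)"
  shows "calm_at f x"
proof -
  have lin: "bounded_linear f'" using assms by (rule has_derivative_bounded_linear)
  obtain K where K: "\<And>h. norm (f' h) \<le> norm h * K" using bounded_linear.bounded[OF lin] by blast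
  obtain d where d: "0 < d" "\<And>y. norm (y - x) < d \<Longrightarrow> norm (f y - f x - f' (y - x)) \<le> 1 * norm (y - x)"
    using assms zero_less_one unfolding has_derivative_at_alt by blast
  have "dist (f y) (f x) \<le> (K + 1) * dist y x" if "dist y x < d" for y
    using norm_triangle_ineq[of "f y - f x - f' (y - x)" "f' (y - x)"] d(2)[of y] K[of "y - x"] that
    by (simp add: dist_norm algebra_simps)
  then show ?thesis unfolding calm_at_def eventually_nhds_metric using d(1) by blast
qed

text \<open>
  On a fine tagged division, the intervals tagged off \<open>S\<close> are controlled by the derivative as in the
  usual proof. An interval tagged at a point \<open>t\<close> of \<open>S\<close> contributes at most the calmness constant
  of \<open>t\<close> times its length; these contributions form a Riemann sum of a function that vanishes outside \<open>S\<close>, and the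
  gauge integral of such a function is zero whatever its values on \<open>S\<close>.
\<close>

lemma fundamental_theorem_of_calculus_negligible:
  fixes f :: "real \<Rightarrow> 'a::banach"
  assumes "a \<le> b" and S: "negligible S"
    and calm: "\<And>t. t \<in> {a..b} \<Longrightarrow> calm_at f t"
    and deriv: "\<And>t. t \<in> {a..b} - S \<Longrightarrow> (f has_vector_derivative f' t) (at t within {a..b})"
  shows "(f' has_integral (f b - f a)) {a..b}"
proof -
  define f0 where "f0 t = (if t \<in> S then 0 else f' t)" for t
  have "\<exists>L d. 0 < d \<and> (\<forall>s. \<bar>s - t\<bar> < d \<longrightarrow> norm (f s - f t) \<le> L * \<bar>s - t\<bar>)" if "t \<in> {a..b}" for t
    using calm[OF that] unfolding calm_at_def eventually_nhds_metric dist_norm real_norm_def by blast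
  then obtain L d1 where d1: "\<And>t. t \<in> {a..b} \<Longrightarrow> 0 < d1 t"
    and L: "\<And>t s. t \<in> {a..b} \<Longrightarrow> s \<in> {a..b} \<Longrightarrow> \<bar>s - t\<bar> < d1 t \<Longrightarrow> norm (f s - f t) \<le> L t * \<bar>s - t\<bar>"
    by metis
  define l where "l t = (if t \<in> S then L t else 0)" for t
  have "(l has_integral 0) {a..b}"
    by (rule has_integral_negligible[OF S]) (simp add: l_def)
  then have l: "\<forall>e>0. \<exists>\<gamma>. gauge \<gamma> \<and> (\<forall>p. p tagged_division_of (cbox a b) \<and> \<gamma> fine p \<longrightarrow>
      norm ((\<Sum>(x, K)\<in>p. content K *\<^sub>R l x) - 0) \<le> e * content (cbox a b))"
    unfolding box_real[symmetric] has_integral_factor_content by blast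
  have "(f0 has_integral (f b - f a)) (cbox a b)"
    unfolding has_integral_factor_content
  proof (intro allI impI)
    fix e :: real assume "0 < e"
    then have e: "0 < e / 2" by simp
    obtain \<gamma>1 where \<gamma>1: "gauge \<gamma>1" and sum_l: "\<And>p. p tagged_division_of (cbox a b) \<Longrightarrow> \<gamma>1 fine p \<Longrightarrow>
        norm (\<Sum>(x, K)\<in>p. content K *\<^sub>R l x) \<le> e / 2 * content (cbox a b)"
      using l e by (metis diff_zero)
    have "\<forall>t. \<exists>d>0. t \<in> {a..b} - S \<longrightarrow>
        (\<forall>s\<in>{a..b}. norm (s - t) < d \<longrightarrow> norm (f s - f t - (s - t) *\<^sub>R f' t) \<le> e / 2 * norm (s - t))"
      using deriv e unfolding has_vector_derivative_def has_derivative_within_alt by (metis zero_less_one)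
    then obtain d2 where d2: "\<And>t. 0 < d2 t" and approx: "\<And>t s. t \<in> {a..b} - S \<Longrightarrow> s \<in> {a..b} \<Longrightarrow>
        norm (s - t) < d2 t \<Longrightarrow> norm (f s - f t - (s - t) *\<^sub>R f' t) \<le> e / 2 * norm (s - t)"
      by metis
    define d where "d t = (if t \<in> {a..b} then min (d1 t) (d2 t) else 1)" for t
    have d: "0 < d t" for t using d1 d2 by (simp add: d_def)
    have loc: "norm (content K *\<^sub>R f0 t - (f (Sup K) - f (Inf K))) \<le> (Sup K - Inf K) * (e / 2) + content K *\<^sub>R l t"
      if ptag: "p tagged_division_of cbox a b" and fine: "(\<lambda>t. ball t (d t)) fine p" and tK: "(t, K) \<in> p" for p t K
    proof -
      have "t \<in> K" "K \<subseteq> cbox a b" using ptag tK by blast+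
      then obtain u v where K: "K = cbox u v" using ptag tK by auto
      have uv: "u \<le> t" "t \<le> v" using \<open>t \<in> K\<close> K by auto
      then have "u \<in> K" "v \<in> K" using K by auto
      then have ab: "t \<in> {a..b}" "u \<in> {a..b}" "v \<in> {a..b}"
        using \<open>t \<in> K\<close> \<open>K \<subseteq> cbox a b\<close> by (auto simp: box_real)
      have "K \<subseteq> ball t (d t)" using fine tK by (auto simp: fine_def)
      then have near: "\<bar>u - t\<bar> < d1 t" "\<bar>v - t\<bar> < d1 t" "\<bar>u - t\<bar> < d2 t" "\<bar>v - t\<bar> < d2 t"
        using \<open>u \<in> K\<close> \<open>v \<in> K\<close> ab by (auto simp: d_def dist_real_def subset_iff)
      have SI: "Sup K = v" "Inf K = u" "content K = v - u" using uv K by auto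
      show ?thesis
      proof (cases "t \<in> S")
        case True
        have "norm (f v - f u) \<le> norm (f v - f t) + norm (f u - f t)"
          using norm_triangle_ineq4[of "f v - f t" "f u - f t"] by simp
        also have "\<dots> \<le> L t * \<bar>v - t\<bar> + L t * \<bar>u - t\<bar>"
          using L ab near by (intro add_mono) auto
        also have "\<dots> = (v - u) * L t" using uv by (simp add: field_simps)
        also have "\<dots> \<le> (v - u) * (e / 2) + (v - u) * L t" using e uv by simp
        finally show ?thesis using True SI by (simp add: f0_def l_def norm_minus_commute)
      next
        case False
        have "norm ((v - u) *\<^sub>R f' t - (f v - f u))
            = norm ((f u - f t - (u - t) *\<^sub>R f' t) - (f v - f t - (v - t) *\<^sub>R f' t))"
          by (simp add: algebra_simps)
        also have "\<dots> \<le> norm (f u - f t - (u - t) *\<^sub>R f' t) + norm (f v - f t - (v - t) *\<^sub>R f' t)"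
          by (rule norm_triangle_ineq4)
        also have "\<dots> \<le> e / 2 * norm (u - t) + e / 2 * norm (v - t)"
          using approx ab near False by (intro add_mono) auto
        also have "\<dots> = (v - u) * (e / 2)" using uv by (simp add: field_simps)
        finally show ?thesis using False SI by (simp add: f0_def l_def)
      qed
    qed
    show "\<exists>\<gamma>. gauge \<gamma> \<and> (\<forall>p. p tagged_division_of cbox a b \<and> \<gamma> fine p \<longrightarrow>
        norm ((\<Sum>(x, K)\<in>p. content K *\<^sub>R f0 x) - (f b - f a)) \<le> e * content (cbox a b))"
    proof (intro exI conjI allI impI)
      show "gauge (\<lambda>t. \<gamma>1 t \<inter> ball t (d t))"
        using \<gamma>1 d gauge_ball_dependent[of d] by (intro gauge_Int) auto
    next
      fix p assume p: "p tagged_division_of cbox a b \<and> (\<lambda>t. \<gamma>1 t \<inter> ball t (d t)) fine p"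
      then have ptag: "p tagged_division_of {a..b}" and fine1: "\<gamma>1 fine p" and fine2: "(\<lambda>t. ball t (d t)) fine p"
        by (auto simp: fine_Int)
      have "norm ((\<Sum>(x, K)\<in>p. content K *\<^sub>R f0 x) - (f b - f a))
          = norm (\<Sum>(x, K)\<in>p. content K *\<^sub>R f0 x - (f (Sup K) - f (Inf K)))"
        using additive_tagged_division_1[OF \<open>a \<le> b\<close> ptag, of f]
        by (simp add: sum_subtractf split_beta)
      also have "\<dots> \<le> (\<Sum>(x, K)\<in>p. (Sup K - Inf K) * (e / 2) + content K *\<^sub>R l x)"
        using loc p fine2 by (intro sum_norm_le) (auto simp: split_beta)
      also have "\<dots> = (\<Sum>(x, K)\<in>p. Sup K - Inf K) * (e / 2) + (\<Sum>(x, K)\<in>p. content K *\<^sub>R l x)"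
        by (simp add: sum.distrib split_beta sum_distrib_right)
      also have "\<dots> \<le> (b - a) * (e / 2) + e / 2 * content (cbox a b)"
        using sum_l[of p] p fine1 additive_tagged_division_1[OF \<open>a \<le> b\<close> ptag, of "\<lambda>x. x"] by auto
      also have "\<dots> = e * content (cbox a b)"
        using \<open>a \<le> b\<close> by (simp add: field_simps)
      finally show "norm ((\<Sum>(x, K)\<in>p. content K *\<^sub>R f0 x) - (f b - f a)) \<le> e * content (cbox a b)" .
    qed
  qed
  then show ?thesis
    by (intro has_integral_spike[OF S, of _ f' f0]) (auto simp: f0_def box_real)
qed

lemma increment_bound:
  fixes f :: "real \<Rightarrow> real"
  assumes "a \<le> b" "negligible S" "\<And>t. t \<in> {a..b} \<Longrightarrow> calm_at f t" and g: "(g has_integral I) {a..b}"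
    and deriv: "\<And>t. t \<in> {a<..<b} - S \<Longrightarrow> \<exists>f'. (f has_real_derivative f') (at t) \<and> f' \<le> g t"
  shows "f b - f a \<le> I"
proof -
  obtain f' where f': "\<And>t. t \<in> {a<..<b} - S \<Longrightarrow> (f has_real_derivative f' t) (at t) \<and> f' t \<le> g t"
    using deriv by metis
  define N where "N = S \<union> {a, b}"
  have N: "negligible N" using assms(2) by (simp add: N_def)
  have "(f' has_integral (f b - f a)) {a..b}"
  proof (rule fundamental_theorem_of_calculus_negligible[OF assms(1) N])
    fix t assume "t \<in> {a..b} - N"
    then have "(f has_real_derivative f' t) (at t)" using f' by (auto simp: N_def)
    then show "(f has_vector_derivative f' t) (at t within {a..b})"
      unfolding has_real_derivative_iff_has_vector_derivative by (rule has_vector_derivative_at_within)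
  qed (use assms in auto)
  then have "((\<lambda>t. if t \<in> N then g t else f' t) has_integral (f b - f a)) {a..b}"
    by (rule has_integral_spike[OF N, rotated]) auto
  then show ?thesis
    by (rule has_integral_le[OF _ g]) (use f' in \<open>auto simp: N_def\<close>)
qed

section \<open>Projections onto convex sets\<close>

lemma prox_eq_closest_point:
  fixes X :: "(real^'n) set"
  assumes "closed X" "convex X" "X \<noteq> {}"
  shows "prox X u = closest_point X u"
proof -
  have "closest_point X u \<in> X" using closest_point_in_set assms by blast
  moreover have "norm (closest_point X u - u) \<le> norm (z - u)" if "z \<in> X" for z
    using closest_point_le[OF assms(1) that, of u] by (simp add: dist_norm norm_minus_commute)
  ultimately have "is_arg_min (\<lambda>z. (norm (z - u))\<^sup>2) (\<lambda>z. z \<in> X) (closest_point X u)"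
    by (auto simp: is_arg_min_def not_less intro!: power_mono)
  then have "is_arg_min (\<lambda>z. (norm (z - u))\<^sup>2) (\<lambda>z. z \<in> X) (prox X u)"
    unfolding prox_def arg_min_on_def arg_min_def by (rule someI)
  then have "prox X u \<in> X" "\<And>z. z \<in> X \<Longrightarrow> (norm (prox X u - u))\<^sup>2 \<le> (norm (z - u))\<^sup>2"
    by (auto simp: is_arg_min_def not_less)
  then show ?thesis
    using assms(1,2) by (intro closest_point_unique) (auto simp: dist_norm norm_minus_commute)
qed

text \<open>
  Comparing each of the two projections with the other point shows that the first-order expansion
  is exact up to \<open>\<parallel>w - u\<parallel>\<^sup>2\<close>: for the upper bound \<open>P u\<close> competes with \<open>P w\<close>, for the lower bound
  \<open>P w\<close> competes with \<open>P u\<close> and nonexpansiveness of \<open>P\<close> absorbs the change of the slope.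
\<close>

lemma sqdist_has_derivative:
  fixes X :: "'a::euclidean_space set"
  assumes "closed X" "convex X" "X \<noteq> {}"
  shows "((\<lambda>u. (norm (u - closest_point X u))\<^sup>2) has_derivative (\<lambda>v. 2 * ((u - closest_point X u) \<bullet> v))) (at u)"
proof -
  define P where "P = closest_point X"
  have PX: "P w \<in> X" for w using closest_point_in_set assms by (auto simp: P_def)
  have le: "(norm (w - P w))\<^sup>2 \<le> (norm (w - z))\<^sup>2" if "z \<in> X" for w z
    using closest_point_le[OF assms(1) that, of w] by (intro power_mono) (auto simp: P_def dist_norm)
  have plus: "(norm (a + b))\<^sup>2 = (norm a)\<^sup>2 + 2 * (a \<bullet> b) + (norm b)\<^sup>2" for a b :: 'a
    by (simp add: power2_norm_eq_inner inner_add_left inner_add_right inner_commute)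
  have minus: "(norm (a - b))\<^sup>2 = (norm a)\<^sup>2 - 2 * (a \<bullet> b) + (norm b)\<^sup>2" for a b :: 'a
    by (simp add: power2_norm_eq_inner inner_diff_left inner_diff_right inner_commute)
  have bound: "\<bar>(norm (w - P w))\<^sup>2 - (norm (u - P u))\<^sup>2 - 2 * ((u - P u) \<bullet> (w - u))\<bar> \<le> (norm (w - u))\<^sup>2" for w
  proof -
    have "(norm (w - P w))\<^sup>2 \<le> (norm ((u - P u) + (w - u)))\<^sup>2" using le[OF PX, of w u] by simp
    then have upper: "(norm (w - P w))\<^sup>2 \<le> (norm (u - P u))\<^sup>2 + 2 * ((u - P u) \<bullet> (w - u)) + (norm (w - u))\<^sup>2"
      by (simp only: plus)
    have "(norm (u - P u))\<^sup>2 \<le> (norm ((w - P w) - (w - u)))\<^sup>2" using le[OF PX, of u w] by simp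
    then have "(norm (u - P u))\<^sup>2 \<le> (norm (w - P w))\<^sup>2 - 2 * ((w - P w) \<bullet> (w - u)) + (norm (w - u))\<^sup>2"
      by (simp only: minus)
    moreover have "(w - P w) \<bullet> (w - u) = (u - P u) \<bullet> (w - u) + (norm (w - u))\<^sup>2 - (P w - P u) \<bullet> (w - u)"
      by (simp add: power2_norm_eq_inner inner_diff_left)
    moreover have "(P w - P u) \<bullet> (w - u) \<le> (norm (w - u))\<^sup>2"
    proof -
      have "(P w - P u) \<bullet> (w - u) \<le> norm (P w - P u) * norm (w - u)" by (rule norm_cauchy_schwarz)
      also have "\<dots> \<le> norm (w - u) * norm (w - u)"
        using closest_point_lipschitz[OF assms(2,1,3), of w u] by (intro mult_right_mono) (auto simp: P_def dist_norm)
      finally show ?thesis by (simp add: power2_eq_square)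
    qed
    ultimately show ?thesis using upper by linarith
  qed
  have "((\<lambda>u. (norm (u - P u))\<^sup>2) has_derivative (\<lambda>v. 2 * ((u - P u) \<bullet> v))) (at u)"
    unfolding has_derivative_at_alt
  proof (intro conjI allI impI)
    show "bounded_linear (\<lambda>v. 2 * ((u - P u) \<bullet> v))"
      by (intro bounded_linear_const_mult bounded_linear_inner_right)
    fix e :: real assume "0 < e"
    have "norm ((norm (w - P w))\<^sup>2 - (norm (u - P u))\<^sup>2 - 2 * ((u - P u) \<bullet> (w - u))) \<le> e * norm (w - u)"
      if "norm (w - u) < e" for w
    proof -
      have "(norm (w - u))\<^sup>2 \<le> e * norm (w - u)"
        using that by (simp add: power2_eq_square mult_right_mono)
      then show ?thesis using bound[of w] by simp
    qed
    then show "\<exists>d>0. \<forall>w. norm (w - u) < d \<longrightarrow>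
        norm ((norm (w - P w))\<^sup>2 - (norm (u - P u))\<^sup>2 - 2 * ((u - P u) \<bullet> (w - u))) \<le> e * norm (w - u)"
      using \<open>0 < e\<close> by blast
  qed
  then show ?thesis by (simp add: P_def)
qed

lemma norm_projected_step_le:
  fixes X :: "'a::euclidean_space set"
  assumes "closed X" "convex X" "x \<in> X"
  shows "norm (closest_point X (x - v) - x) \<le> norm v"
proof -
  have "dist (closest_point X (x - v)) (closest_point X x) \<le> dist (x - v) x"
    using assms by (intro closest_point_lipschitz) auto
  then show ?thesis using assms by (simp add: closest_point_self dist_norm)
qed

section \<open>Conservative fields\<close>

lemma lipschitz_imp_abs_continuous_curve:
  assumes "L-lipschitz_on UNIV \<gamma>"
  shows "abs_continuous_curve \<gamma>"
  unfolding abs_continuous_curve_def abs_continuous_on_Icc_def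
proof (intro allI impI)
  fix b e :: real assume "0 < e"
  have L: "0 \<le> L" using assms by (rule lipschitz_on_nonneg)
  show "\<exists>\<delta>>0. \<forall>D U. D division_of U \<and> U \<subseteq> {0..b} \<and> (\<Sum>K\<in>D. Sup K - Inf K) < \<delta> \<longrightarrow>
      (\<Sum>K\<in>D. norm (\<gamma> (Sup K) - \<gamma> (Inf K))) < e"
  proof (intro exI conjI allI impI)
    show "0 < e / (L + 1)" using \<open>0 < e\<close> L by simp
    fix D U assume D: "D division_of U \<and> U \<subseteq> {0..b} \<and> (\<Sum>K\<in>D. Sup K - Inf K) < e / (L + 1)"
    have le: "Inf K \<le> Sup K" if K: "K \<in> D" for K
    proof -
      obtain p q where "K = cbox p q" "K \<noteq> {}" using division_ofD(3,4) D K by metis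
      then show ?thesis by auto
    qed
    have "(\<Sum>K\<in>D. norm (\<gamma> (Sup K) - \<gamma> (Inf K))) \<le> (\<Sum>K\<in>D. (L + 1) * (Sup K - Inf K))"
    proof (rule sum_mono)
      fix K assume "K \<in> D"
      then have "norm (\<gamma> (Sup K) - \<gamma> (Inf K)) \<le> L * (Sup K - Inf K)"
        using lipschitz_onD[OF assms, of "Sup K" "Inf K"] le by (simp add: dist_norm)
      also have "\<dots> \<le> (L + 1) * (Sup K - Inf K)" using le[OF \<open>K \<in> D\<close>] by (intro mult_right_mono) auto
      finally show "norm (\<gamma> (Sup K) - \<gamma> (Inf K)) \<le> (L + 1) * (Sup K - Inf K)" .
    qed
    also have "\<dots> = (L + 1) * (\<Sum>K\<in>D. Sup K - Inf K)" by (simp add: sum_distrib_left)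
    also have "\<dots> < e" using D L by (simp add: field_simps)
    finally show "(\<Sum>K\<in>D. norm (\<gamma> (Sup K) - \<gamma> (Inf K))) < e" .
  qed
qed

text \<open>
  Besides the chain rule this yields the almost everywhere differentiability of Lipschitz curves.
  For that reason it is applied to the curve of auxiliary variables as well.
\<close>

lemma conservative_field_chain_rule:
  assumes "conservative_field h D" "L-lipschitz_on UNIV \<gamma>"
  obtains S where "negligible S" "\<And>t. 0 \<le> t \<Longrightarrow> t \<notin> S \<Longrightarrow> \<exists>v. (\<gamma> has_vector_derivative v) (at t) \<and>
    (\<forall>d\<in>D (\<gamma> t). ((h \<circ> \<gamma>) has_real_derivative (d \<bullet> v)) (at t))"
proof -
  let ?Q = "\<lambda>t. \<exists>v. (\<gamma> has_vector_derivative v) (at t) \<and>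
    (\<forall>d\<in>D (\<gamma> t). ((h \<circ> \<gamma>) has_real_derivative (d \<bullet> v)) (at t))"
  have "AE t in lebesgue_on {0..}. ?Q t"
    using assms(1) lipschitz_imp_abs_continuous_curve[OF assms(2)] by (auto simp: conservative_field_def)
  then have "AE t in lebesgue. t \<in> {0..} \<longrightarrow> ?Q t"
    by (subst (asm) AE_restrict_space_iff) auto
  then obtain S where "S \<in> null_sets lebesgue" "{t \<in> space lebesgue. \<not> (t \<in> {0..} \<longrightarrow> ?Q t)} \<subseteq> S"
    by (auto simp: eventually_ae_filter)
  then have "negligible S" "\<And>t. 0 \<le> t \<Longrightarrow> t \<notin> S \<Longrightarrow> ?Q t"
    by (auto simp: negligible_iff_null_sets)
  then show ?thesis by (rule that)
qed

lemma conservative_field_bounded_on_compact: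
  assumes "conservative_field h D" "compact K"
  shows "bounded (\<Union>z\<in>K. D z)"
proof -
  obtain U where U: "\<And>x. open (U x)" "\<And>x. x \<in> U x" "\<And>x. bounded (\<Union>z\<in>U x. D z)"
    using assms(1) unfolding conservative_field_def by metis
  obtain C where C: "C \<subseteq> K" "finite C" "K \<subseteq> (\<Union>c\<in>C. U c)"
    using compactE_image[OF assms(2), of K U] U by blast
  have "bounded (\<Union>c\<in>C. \<Union>z\<in>U c. D z)" using C(2) U(3) by blast
  then show ?thesis by (rule bounded_subset) (use C(3) in blast)
qed

lemma conservative_field_closed_value:
  assumes "conservative_field h D"
  shows "closed (D x)"
proof -
  have cl: "closed {(x, d). d \<in> D x}" using assms by (auto simp: conservative_field_def)
  have "D x = (\<lambda>d. (x, d)) -` {(x, d). d \<in> D x}" by auto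
  moreover have "closed ((\<lambda>d. (x, d)) -` {(x, d). d \<in> D x})"
    using cl by (rule closed_vimage) (intro continuous_intros)
  ultimately show ?thesis by metis
qed

text \<open>
  A locally bounded set-valued map with closed graph is upper semicontinuous: elements of \<open>D\<close> at
  points tending to \<open>x\<close> are bounded and subconverge to an element of \<open>D x\<close>.
\<close>

lemma conservative_field_upper_semicontinuous:
  assumes D: "conservative_field h D" and "0 < e"
  obtains \<rho> where "0 < \<rho>" "\<And>z d. dist z x < \<rho> \<Longrightarrow> d \<in> D z \<Longrightarrow> \<exists>d'\<in>D x. dist d d' < e"
proof (rule ccontr)
  assume neg: "\<not> thesis"
  have "\<exists>z d. dist z x < 1 / real (Suc n) \<and> d \<in> D z \<and> (\<forall>d'\<in>D x. e \<le> dist d d')" for n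
  proof (rule ccontr)
    assume "\<not> ?thesis"
    then have "\<And>z d. dist z x < 1 / real (Suc n) \<Longrightarrow> d \<in> D z \<Longrightarrow> \<exists>d'\<in>D x. dist d d' < e"
      by (meson linorder_not_less)
    then show False using neg that[of "1 / real (Suc n)"] by simp
  qed
  then obtain z d where z: "\<And>n. dist (z n) x < 1 / real (Suc n)" and d: "\<And>n. d n \<in> D (z n)"
    and far: "\<And>n d'. d' \<in> D x \<Longrightarrow> e \<le> dist (d n) d'"
    by metis
  have z_lim: "z \<longlonglongrightarrow> x"
    unfolding tendsto_iff
  proof (intro allI impI)
    fix r :: real assume "0 < r"
    then have "\<forall>\<^sub>F n in sequentially. 1 / real (Suc n) < r"
      using order_tendstoD(2)[OF LIMSEQ_inverse_real_of_nat, of r] by (simp add: inverse_eq_divide)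
    then show "\<forall>\<^sub>F n in sequentially. dist (z n) x < r"
      by eventually_elim (use z in \<open>meson less_trans\<close>)
  qed
  have "z n \<in> cball x 1" for n
  proof -
    have "1 / real (Suc n) \<le> 1" by simp
    with z[of n] have "dist (z n) x \<le> 1" by linarith
    then show ?thesis by (simp add: dist_commute)
  qed
  then have "range d \<subseteq> (\<Union>z\<in>cball x 1. D z)" using d by blast
  then have "bounded (range d)"
    using conservative_field_bounded_on_compact[OF D compact_cball] bounded_subset by blast
  then obtain l r where r: "strict_mono (r :: nat \<Rightarrow> nat)" "(d \<circ> r) \<longlonglongrightarrow> l"
    using bounded_imp_convergent_subsequence by blast
  have "(\<lambda>n. (z (r n), d (r n))) \<longlonglongrightarrow> (x, l)"
    using LIMSEQ_subseq_LIMSEQ[OF z_lim r(1)] r(2) by (intro tendsto_Pair) (auto simp: o_def)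
  moreover have "closed {(x, d). d \<in> D x}" using D by (auto simp: conservative_field_def)
  ultimately have "(x, l) \<in> {(x, d). d \<in> D x}"
    by (rule Lim_in_closed_set[rotated 3]) (use d in auto)
  then have "e \<le> dist (d (r n)) l" for n using far by auto
  moreover have "\<forall>\<^sub>F n in sequentially. dist (d (r n)) l < e"
    using r(2) \<open>0 < e\<close> by (auto simp: tendsto_iff)
  ultimately show False by (auto simp: not_less[symmetric] eventually_sequentially)
qed

lemma locally_lipschitz_calm_at: "locally_lipschitz h \<Longrightarrow> calm_at h x"
  unfolding locally_lipschitz_def by (metis calm_at_lipschitz centre_in_ball open_ball)

lemma expansion_witness:
  assumes D: "conservative_field h D" and w: "w \<in> expansion D \<delta> x"
  obtains z d where "norm (z - x) \<le> \<delta>" "d \<in> D z" "norm (w - d) \<le> \<delta>"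
proof -
  obtain z where z: "norm (z - x) \<le> \<delta>" "D z \<noteq> {}" "infdist w (D z) \<le> \<delta>"
    using w by (auto simp: expansion_def)
  obtain d where "d \<in> D z" "infdist w (D z) = dist w d"
    using infdist_attains_inf[OF conservative_field_closed_value[OF D] z(2)] by metis
  then show ?thesis using that z by (simp add: dist_norm)
qed

section \<open>Limit curves of noisy recursions\<close>

text \<open>
  The setting of the limit theorem: increments \<open>\<eta> k (u k + \<zeta> k)\<close> whose drift \<open>u k\<close> is close to the
  convex set \<open>F p\<close> when the iterate is close to \<open>p\<close>, and whose noise \<open>\<zeta> k\<close> cancels out on every
  window of bounded length in the time scale \<open>\<sigma>\<close>.
\<close>

locale noisy_inclusion =
  fixes z u \<zeta> :: "nat \<Rightarrow> 'a::euclidean_space" and \<eta> :: "nat \<Rightarrow> real"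
    and F :: "'a \<Rightarrow> 'a set" and B :: real
  assumes step: "z (Suc k) = z k + \<eta> k *\<^sub>R (u k + \<zeta> k)"
    and step_pos: "0 < \<eta> k" and step_lim: "\<eta> \<longlonglongrightarrow> 0"
    and step_div: "filterlim (step_sum \<eta>) at_top sequentially"
    and bounded_iterates: "bounded (range z)"
    and drift_bound: "norm (u k) \<le> B" and noise_bound: "norm (\<zeta> k) \<le> B"
    and noise: "0 < T \<Longrightarrow> 0 < e \<Longrightarrow>
      \<forall>\<^sub>F i in sequentially. \<forall>j\<ge>i. step_sum \<eta> j \<le> step_sum \<eta> i + T \<longrightarrow> norm (\<Sum>k=i..j. \<eta> k *\<^sub>R \<zeta> k) \<le> e"
    and closed_field: "p \<in> closure (range z) \<Longrightarrow> closed (F p)"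
    and convex_field: "p \<in> closure (range z) \<Longrightarrow> convex (F p)"
    and drift_near_field: "p \<in> closure (range z) \<Longrightarrow> 0 < e \<Longrightarrow> \<exists>d>0. \<forall>\<^sub>F k in sequentially.
      dist (z k) p < d \<longrightarrow> u k \<in> {a + b | a b. a \<in> F p \<and> b \<in> cball 0 e}"
begin

abbreviation \<sigma> :: "nat \<Rightarrow> real" where "\<sigma> \<equiv> step_sum \<eta>"

lemma sigma_Suc: "\<sigma> (Suc k) = \<sigma> k + \<eta> k"
  by (simp add: step_sum_def)

lemma sigma_strict_mono: "strict_mono \<sigma>"
  by (rule strict_mono_Suc_iff[THEN iffD2]) (simp add: sigma_Suc step_pos)

lemma sigma_mono: "i \<le> j \<Longrightarrow> \<sigma> i \<le> \<sigma> j"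
  using sigma_strict_mono by (simp add: strict_mono_less_eq)

lemma B_nonneg: "0 \<le> B"
  using drift_bound[of 0] norm_ge_zero order_trans by blast

lemma index_at_time:
  assumes "0 \<le> t"
  obtains m where "i \<le> m" "\<sigma> m \<le> \<sigma> i + t" "\<sigma> i + t < \<sigma> (Suc m)"
proof -
  have "\<forall>\<^sub>F n in sequentially. \<sigma> i + t < \<sigma> n"
    using step_div by (simp add: filterlim_at_top_dense)
  then have ex: "\<exists>n. \<sigma> i + t < \<sigma> n"
    by (rule eventually_happens'[OF sequentially_bot])
  define n where "n = (LEAST n. \<sigma> i + t < \<sigma> n)"
  have n: "\<sigma> i + t < \<sigma> n" "\<And>k. k < n \<Longrightarrow> \<not> \<sigma> i + t < \<sigma> k"
    unfolding n_def using LeastI_ex[OF ex] by (auto dest: not_less_Least)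
  have "i < n" using n(1) assms sigma_mono[of n i] by (cases "i < n") auto
  then have "i \<le> n - 1" "Suc (n - 1) = n" by auto
  moreover have "\<sigma> (n - 1) \<le> \<sigma> i + t" using n(2)[of "n - 1"] \<open>i < n\<close> by auto
  ultimately show ?thesis using that n(1) by metis
qed

text \<open>
  The length of the part of the step interval \<open>[\<sigma> k, \<sigma> (k + 1)]\<close> that lies before time \<open>\<sigma> i + t\<close>.
  Written with these weights, an increment of the piecewise linear interpolation over \<open>[s, t]\<close> is
  \<open>t - s\<close> times a convex combination of the step directions met in between. Lipschitz
  continuity and the differential inclusion for the limit both come from this.
\<close>

definition overlap :: "nat \<Rightarrow> real \<Rightarrow> nat \<Rightarrow> real" where
  "overlap i t k = max 0 (min (\<eta> k) (\<sigma> i + t - \<sigma> k))"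

definition interp :: "nat \<Rightarrow> nat \<Rightarrow> real \<Rightarrow> 'a" where
  "interp i N t = z i + (\<Sum>k=i..<N. overlap i t k *\<^sub>R (u k + \<zeta> k))"

lemma overlap_mono: "s \<le> t \<Longrightarrow> overlap i s k \<le> overlap i t k"
  by (auto simp: overlap_def)

lemma overlap_full: "k < m \<Longrightarrow> \<sigma> m \<le> \<sigma> i + t \<Longrightarrow> overlap i t k = \<eta> k"
  using sigma_mono[of "Suc k" m] step_pos[of k] by (simp add: overlap_def sigma_Suc)

lemma overlap_empty: "\<sigma> i + t \<le> \<sigma> k \<Longrightarrow> overlap i t k = 0"
  by (simp add: overlap_def)

lemma sum_overlap:
  assumes "i \<le> N" "0 \<le> t"
  shows "(\<Sum>k=i..<N. overlap i t k) = min t (\<sigma> N - \<sigma> i)"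
  using assms(1)
proof (induction N rule: dec_induct)
  case base
  then show ?case using assms by simp
next
  case (step n)
  then show ?case using step_pos[of n] sigma_mono[of i n] by (auto simp: overlap_def sigma_Suc)
qed

lemma sum_steps: "i \<le> m \<Longrightarrow> (\<Sum>k=i..<m. \<eta> k *\<^sub>R (u k + \<zeta> k)) = z m - z i"
  by (induction m rule: dec_induct) (simp_all add: step)

lemma interp_node:
  assumes "i \<le> m" "m \<le> N"
  shows "interp i N (\<sigma> m - \<sigma> i) = z m"
proof -
  have "(\<Sum>k=i..<N. overlap i (\<sigma> m - \<sigma> i) k *\<^sub>R (u k + \<zeta> k))
      = (\<Sum>k=i..<m. overlap i (\<sigma> m - \<sigma> i) k *\<^sub>R (u k + \<zeta> k))
        + (\<Sum>k=m..<N. overlap i (\<sigma> m - \<sigma> i) k *\<^sub>R (u k + \<zeta> k))"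
    using assms by (simp add: sum.atLeastLessThan_concat)
  also have "(\<Sum>k=m..<N. overlap i (\<sigma> m - \<sigma> i) k *\<^sub>R (u k + \<zeta> k)) = 0"
    using sigma_mono by (intro sum.neutral) (auto simp: overlap_empty)
  also have "(\<Sum>k=i..<m. overlap i (\<sigma> m - \<sigma> i) k *\<^sub>R (u k + \<zeta> k)) = z m - z i"
    using sum_steps[OF assms(1)] by (simp add: overlap_full[of _ m])
  finally show ?thesis by (simp add: interp_def)
qed

lemma interp_diff:
  "interp i N t - interp i N s = (\<Sum>k=i..<N. (overlap i t k - overlap i s k) *\<^sub>R (u k + \<zeta> k))"
  by (simp add: interp_def sum_subtractf scaleR_left_diff_distrib)

lemma interp_lipschitz:
  assumes "i \<le> N" "T \<le> \<sigma> N - \<sigma> i" "s \<in> {0..T}" "t \<in> {0..T}"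
  shows "norm (interp i N t - interp i N s) \<le> 2 * B * \<bar>t - s\<bar>"
proof -
  have main: "norm (interp i N t - interp i N s) \<le> 2 * B * (t - s)"
    if "s \<le> t" "s \<in> {0..T}" "t \<in> {0..T}" for s t
  proof -
    have "norm (interp i N t - interp i N s) \<le> (\<Sum>k=i..<N. (overlap i t k - overlap i s k) * (2 * B))"
      unfolding interp_diff
    proof (rule sum_norm_le)
      fix k
      have "norm (u k + \<zeta> k) \<le> 2 * B"
        using norm_triangle_ineq[of "u k" "\<zeta> k"] drift_bound[of k] noise_bound[of k] by linarith
      then show "norm ((overlap i t k - overlap i s k) *\<^sub>R (u k + \<zeta> k)) \<le> (overlap i t k - overlap i s k) * (2 * B)"
        using overlap_mono[OF that(1), of i k] by (simp add: mult_left_mono)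
    qed
    also have "\<dots> = (t - s) * (2 * B)"
      using that assms sum_overlap[of i N t] sum_overlap[of i N s]
      by (simp add: sum_subtractf flip: sum_distrib_right)
    finally show ?thesis by (simp add: mult.commute)
  qed
  show ?thesis
  proof (cases "s \<le> t")
    case True
    then show ?thesis using main[of s t] assms by simp
  next
    case False
    then show ?thesis using main[of t s] assms by (simp add: norm_minus_commute)
  qed
qed

text \<open>
  Only the last step can be partially covered, so the weighted sum is a convex combination of two
  consecutive partial sums of the noise.
\<close>

lemma weighted_noise_bound:
  assumes "i \<le> N" "0 \<le> e"
    and partial: "\<And>j. i \<le> j \<Longrightarrow> \<sigma> j \<le> \<sigma> i + t \<Longrightarrow> norm (\<Sum>k=i..j. \<eta> k *\<^sub>R \<zeta> k) \<le> e"
  shows "norm (\<Sum>k=i..<N. overlap i t k *\<^sub>R \<zeta> k) \<le> e"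
  using assms(1)
proof (induction N rule: dec_induct)
  case base
  then show ?case using assms by simp
next
  case (step n)
  show ?case
  proof (cases "\<sigma> n < \<sigma> i + t")
    case False
    then show ?thesis using step by (simp add: overlap_empty)
  next
    case True
    define S where "S = (\<Sum>k=i..<n. \<eta> k *\<^sub>R \<zeta> k)"
    define \<theta> where "\<theta> = overlap i t n / \<eta> n"
    have \<theta>: "0 \<le> \<theta>" "\<theta> \<le> 1" "overlap i t n = \<theta> * \<eta> n"
      using step_pos[of n] by (auto simp: \<theta>_def overlap_def)
    have full: "(\<Sum>k=i..<n. overlap i t k *\<^sub>R \<zeta> k) = S"
      unfolding S_def using True by (intro sum.cong) (auto simp: overlap_full[of _ n])
    have "{i..n} = insert n {i..<n}" using step.hyps by auto
    then have "(\<Sum>k=i..n. \<eta> k *\<^sub>R \<zeta> k) = S + \<eta> n *\<^sub>R \<zeta> n"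
      by (simp add: S_def add.commute)
    then have "norm (S + \<eta> n *\<^sub>R \<zeta> n) \<le> e" using partial[of n] True step.hyps by simp
    moreover have "norm S \<le> e" using step.IH full by simp
    ultimately have "(1 - \<theta>) *\<^sub>R S + \<theta> *\<^sub>R (S + \<eta> n *\<^sub>R \<zeta> n) \<in> cball 0 e"
      using \<theta> convexD_alt[OF convex_cball, of S 0 e "S + \<eta> n *\<^sub>R \<zeta> n" \<theta>] by simp
    moreover have "(1 - \<theta>) *\<^sub>R S + \<theta> *\<^sub>R (S + \<eta> n *\<^sub>R \<zeta> n) = (\<Sum>k=i..<Suc n. overlap i t k *\<^sub>R \<zeta> k)"
      using step.hyps \<theta> by (simp add: full algebra_simps)
    ultimately show ?thesis by simp
  qed
qed

text \<open>
  The Lipschitz constant \<open>2 * B\<close> is the one inherited from the iterates, whose increments have norm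
  at most \<open>2 * B * \<eta> k\<close>.
\<close>

definition solution :: "real \<Rightarrow> (real \<Rightarrow> 'a) \<Rightarrow> bool" where
  "solution T w \<longleftrightarrow> (2 * B)-lipschitz_on UNIV w \<and> (\<forall>t\<in>{0..T}. w t \<in> closure (range z)) \<and>
     (\<forall>t\<in>{0<..<T}. \<forall>v. (w has_vector_derivative v) (at t) \<longrightarrow> v \<in> F (w t))"

definition shadows :: "real \<Rightarrow> (nat \<Rightarrow> nat) \<Rightarrow> (real \<Rightarrow> 'a) \<Rightarrow> bool" where
  "shadows T \<iota> w \<longleftrightarrow> (\<forall>e>0. \<forall>\<^sub>F n in sequentially. \<forall>m\<ge>\<iota> n.
     \<sigma> m \<le> \<sigma> (\<iota> n) + T \<longrightarrow> dist (z m) (w (\<sigma> m - \<sigma> (\<iota> n))) < e)"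

text \<open>
  A subsequence of the shifted interpolations converges uniformly by the theorem of Arzela and
  Ascoli. A difference quotient of the limit is the limit of convex combinations of drifts at
  iterates near \<open>w t\<close>, up to noise that vanishes. These drifts lie in a closed convex neighbourhood
  of \<open>F (w t)\<close>, hence so do the difference quotients, and hence their limit lies in \<open>F (w t)\<close>.
\<close>

lemma limit_curve:
  assumes \<iota>: "filterlim \<iota> at_top sequentially" and T: "0 < T"
  obtains r w where "strict_mono r" "solution T w" "shadows T (\<lambda>n. \<iota> (r n)) w"
proof -
  have "\<exists>N. i \<le> N \<and> \<sigma> i + T \<le> \<sigma> N" for i
  proof -
    obtain m where "i \<le> m" "\<sigma> i + T < \<sigma> (Suc m)" using index_at_time[of T i] T by auto
    then show ?thesis by (intro exI[of _ "Suc m"]) auto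
  qed
  then obtain end' where end': "\<And>i. i \<le> end' i" "\<And>i. \<sigma> i + T \<le> \<sigma> (end' i)"
    by metis
  define W where "W n = interp (\<iota> n) (end' (\<iota> n))" for n
  have W_lip: "norm (W n t - W n s) \<le> 2 * B * \<bar>t - s\<bar>" if "s \<in> {0..T}" "t \<in> {0..T}" for n s t
    using interp_lipschitz[of "\<iota> n" "end' (\<iota> n)" T s t] end'[of "\<iota> n"] that by (simp add: W_def)
  have W_node: "W n (\<sigma> m - \<sigma> (\<iota> n)) = z m" if "\<iota> n \<le> m" "\<sigma> m \<le> \<sigma> (\<iota> n) + T" for n m
  proof -
    have "m \<le> end' (\<iota> n)"
      using that(2) end'(2)[of "\<iota> n"] strict_mono_less_eq[OF sigma_strict_mono, of m "end' (\<iota> n)"] by linarith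
    then show ?thesis using that(1) by (simp add: W_def interp_node)
  qed
  obtain M where M: "\<And>k. norm (z k) \<le> M" using bounded_iterates by (auto simp: bounded_iff)
  obtain w0 r where "continuous_on {0..T} w0" and r: "strict_mono (r :: nat \<Rightarrow> nat)"
    and unif: "\<And>e. 0 < e \<Longrightarrow> \<exists>N. \<forall>n t. n \<ge> N \<and> t \<in> {0..T} \<longrightarrow> norm (W (r n) t - w0 t) < e"
  proof (rule Arzela_Ascoli[of "{0..T}" W "M + 2 * B * T"])
    show "norm (W n t) \<le> M + 2 * B * T" if "t \<in> {0..T}" for n t
    proof -
      have "W n 0 = z (\<iota> n)" using W_node[of n "\<iota> n"] T by simp
      moreover have "norm (W n t) \<le> norm (W n 0) + norm (W n t - W n 0)"
        using norm_triangle_sub[of "W n t" "W n 0"] by simp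
      moreover have "2 * B * \<bar>t - 0\<bar> \<le> 2 * B * T" using that B_nonneg by (simp add: mult_left_mono)
      ultimately show ?thesis using W_lip[of 0 t n] that M[of "\<iota> n"] by simp
    qed
    show "\<exists>d>0. \<forall>n s. s \<in> {0..T} \<and> norm (t - s) < d \<longrightarrow> norm (W n t - W n s) < e"
      if "t \<in> {0..T}" "0 < e" for t e
    proof (intro exI conjI allI impI)
      show "0 < e / (2 * B + 1)" using that B_nonneg by simp
      fix n s assume s: "s \<in> {0..T} \<and> norm (t - s) < e / (2 * B + 1)"
      then have "\<bar>t - s\<bar> * (2 * B + 1) < e" using B_nonneg by (simp add: field_simps)
      moreover have "2 * B * \<bar>t - s\<bar> \<le> \<bar>t - s\<bar> * (2 * B + 1)" by (simp add: algebra_simps)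
      ultimately show "norm (W n t - W n s) < e" using W_lip[of s t n] s that by simp
    qed
  qed auto
  have unif': "\<forall>\<^sub>F n in sequentially. \<forall>t\<in>{0..T}. norm (W (r n) t - w0 t) < e" if "0 < e" for e
    using unif[OF that] unfolding eventually_sequentially by blast
  have ptw: "(\<lambda>n. W (r n) t) \<longlonglongrightarrow> w0 t" if "t \<in> {0..T}" for t
    unfolding tendsto_iff dist_norm
  proof (intro allI impI)
    fix e :: real assume "0 < e"
    from unif'[OF this] show "\<forall>\<^sub>F n in sequentially. norm (W (r n) t - w0 t) < e"
      by (rule eventually_mono) (use that in blast)
  qed
  have w0_lip: "norm (w0 t - w0 s) \<le> 2 * B * \<bar>t - s\<bar>" if "s \<in> {0..T}" "t \<in> {0..T}" for s t
  proof (rule tendsto_upperbound)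
    show "(\<lambda>n. norm (W (r n) t - W (r n) s)) \<longlonglongrightarrow> norm (w0 t - w0 s)"
      by (intro tendsto_intros ptw that)
  qed (use W_lip that in auto)
  define w where "w t = w0 (max 0 (min T t))" for t
  have w_eq: "w t = w0 t" if "t \<in> {0..T}" for t using that by (simp add: w_def)
  have w_lip: "(2 * B)-lipschitz_on UNIV w"
  proof (rule lipschitz_onI)
    fix s t :: real
    have "norm (w s - w t) \<le> 2 * B * \<bar>max 0 (min T s) - max 0 (min T t)\<bar>"
      unfolding w_def using T by (intro w0_lip) auto
    also have "\<dots> \<le> 2 * B * \<bar>s - t\<bar>" using B_nonneg by (intro mult_left_mono) auto
    finally show "dist (w s) (w t) \<le> 2 * B * dist s t" by (simp add: dist_norm)
  qed (simp add: B_nonneg)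
  have \<iota>r: "filterlim (\<lambda>n. \<iota> (r n)) at_top sequentially"
    by (rule filterlim_compose[OF \<iota> filterlim_subseq[OF r]])
  have near: "\<forall>\<^sub>F n in sequentially. \<forall>m\<ge>\<iota> (r n).
       \<sigma> m \<le> \<sigma> (\<iota> (r n)) + T \<longrightarrow> dist (z m) (w (\<sigma> m - \<sigma> (\<iota> (r n)))) < e" if "0 < e" for e
    using unif'[OF that]
  proof eventually_elim
    case (elim n)
    show ?case
    proof (intro allI impI)
      fix m assume m: "\<iota> (r n) \<le> m" "\<sigma> m \<le> \<sigma> (\<iota> (r n)) + T"
      then have "\<sigma> m - \<sigma> (\<iota> (r n)) \<in> {0..T}" using sigma_mono by auto
      then show "dist (z m) (w (\<sigma> m - \<sigma> (\<iota> (r n)))) < e"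
        using elim W_node[OF m] by (metis w_eq dist_norm)
    qed
  qed
  have small_steps: "\<forall>\<^sub>F n in sequentially. \<forall>k\<ge>\<iota> (r n). \<eta> k < e" if "0 < e" for e
  proof -
    have "\<forall>\<^sub>F i in sequentially. \<forall>k\<ge>i. \<eta> k < e"
      using order_tendstoD(2)[OF step_lim that] by (simp add: eventually_all_ge_at_top)
    then show ?thesis using \<iota>r by (rule eventually_compose_filterlim)
  qed
  have in_closure: "w t \<in> closure (range z)" if t: "t \<in> {0..T}" for t
    unfolding closure_approachable
  proof (intro allI impI)
    fix e :: real assume e: "0 < e"
    have e': "0 < e / (4 * B + 2)" using e B_nonneg by simp
    have "\<forall>\<^sub>F n in sequentially. \<exists>y\<in>range z. dist y (w t) < e"
      using near[OF half_gt_zero[OF e]] small_steps[OF e']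
    proof eventually_elim
      case (elim n)
      obtain m where m: "\<iota> (r n) \<le> m" "\<sigma> m \<le> \<sigma> (\<iota> (r n)) + t" "\<sigma> (\<iota> (r n)) + t < \<sigma> (Suc m)"
        using index_at_time t by (metis atLeastAtMost_iff)
      have "\<bar>\<sigma> m - \<sigma> (\<iota> (r n)) - t\<bar> \<le> e / (4 * B + 2)"
        using m elim(2) sigma_Suc[of m] by (smt (verit))
      then have "2 * B * \<bar>\<sigma> m - \<sigma> (\<iota> (r n)) - t\<bar> \<le> 2 * B * (e / (4 * B + 2))"
        using B_nonneg by (intro mult_left_mono) auto
      also have "\<dots> \<le> e / 2" using B_nonneg e by (simp add: field_simps)
      finally have "dist (w (\<sigma> m - \<sigma> (\<iota> (r n)))) (w t) \<le> e / 2"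
        using lipschitz_onD[OF w_lip, of "\<sigma> m - \<sigma> (\<iota> (r n))" t] by (simp add: dist_real_def)
      moreover have "dist (z m) (w (\<sigma> m - \<sigma> (\<iota> (r n)))) < e / 2" using elim(1) m t by simp
      ultimately have "dist (z m) (w t) < e"
        using dist_triangle[of "z m" "w t" "w (\<sigma> m - \<sigma> (\<iota> (r n)))"] by linarith
      then show ?case by blast
    qed
    then show "\<exists>y\<in>range z. dist y (w t) < e"
      using eventually_happens'[OF sequentially_bot] by blast
  qed
  have inclusion: "v \<in> F (w t)" if t: "t \<in> {0<..<T}" and v: "(w has_vector_derivative v) (at t)" for t v
  proof -
    have wt: "w t \<in> closure (range z)" using in_closure t by simp
    have "v \<in> closure (F (w t))"
      unfolding closure_approachable
    proof (intro allI impI)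
      fix e0 :: real assume "0 < e0"
      define e where "e = e0 / 3"
      have e: "0 < e" using \<open>0 < e0\<close> by (simp add: e_def)
      define G where "G = {a + b | a b. a \<in> F (w t) \<and> b \<in> cball 0 e}"
      have G_eq: "G = (\<Union>x\<in>F (w t). \<Union>y\<in>cball 0 e. {x + y})" unfolding G_def by blast
      have closed: "closed G"
        unfolding G_eq by (rule closed_compact_sums[OF closed_field[OF wt] compact_cball])
      have convex: "convex G"
        unfolding G_eq by (rule convex_sums[OF convex_field[OF wt] convex_cball])
      obtain d where d: "0 < d" and drift: "\<forall>\<^sub>F k in sequentially. dist (z k) (w t) < d \<longrightarrow> u k \<in> G"
        using drift_near_field[OF wt e] unfolding G_def by blast
      obtain s0 where s0: "0 < s0" and
        diff: "\<And>y. norm (y - t) < s0 \<Longrightarrow> norm (w y - w t - (y - t) *\<^sub>R v) \<le> e * norm (y - t)"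
        using v e unfolding has_vector_derivative_def has_derivative_at_alt by blast
      \<comment> \<open>With this \<open>s\<close> the interpolations move by at most \<open>d / 4\<close> during \<open>[t, t + s]\<close>. The step that
        straddles \<open>t\<close> and the uniform error add at most \<open>d / 4\<close> each.\<close>
      define s where "s = min (min (s0 / 2) ((T - t) / 2)) (d / (8 * B + 8))"
      have "0 < d / (8 * B + 8)" using d B_nonneg by (intro divide_pos_pos) auto
      then have "0 < s" using s0 t by (simp add: s_def)
      moreover have "s \<le> s0 / 2" "s \<le> (T - t) / 2" unfolding s_def by linarith+
      ultimately have s: "0 < s" "s < s0" "t + s < T" using s0 t by auto
      have "2 * B * s \<le> 2 * B * (d / (8 * B + 8))" using B_nonneg by (intro mult_left_mono) (auto simp: s_def)
      also have "\<dots> \<le> d / 4" using B_nonneg d by (simp add: field_simps)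
      finally have sB: "2 * B * s \<le> d / 4" .
      define q where "q n = (\<Sum>k=\<iota> (r n)..<end' (\<iota> (r n)).
          ((overlap (\<iota> (r n)) (t + s) k - overlap (\<iota> (r n)) t k) / s) *\<^sub>R u k)" for n
      define \<nu> where "\<nu> t n = (\<Sum>k=\<iota> (r n)..<end' (\<iota> (r n)). overlap (\<iota> (r n)) t k *\<^sub>R \<zeta> k)" for t n
      have \<nu>: "\<nu> t' \<longlonglongrightarrow> 0" if t': "0 < t'" "t' \<le> T" for t'
        unfolding tendsto_iff
      proof (intro allI impI)
        fix e :: real assume e: "0 < e"
        have "\<forall>\<^sub>F n in sequentially. \<forall>j\<ge>\<iota> (r n). \<sigma> j \<le> \<sigma> (\<iota> (r n)) + t' \<longrightarrow>
            norm (\<Sum>k=\<iota> (r n)..j. \<eta> k *\<^sub>R \<zeta> k) \<le> e / 2"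
          using noise[OF t'(1) half_gt_zero[OF e]] \<iota>r by (rule eventually_compose_filterlim)
        then show "\<forall>\<^sub>F n in sequentially. dist (\<nu> t' n) 0 < e"
        proof eventually_elim
          case (elim n)
          then have "norm (\<nu> t' n) \<le> e / 2"
            unfolding \<nu>_def using e end' by (intro weighted_noise_bound) auto
          then show ?case using e by simp
        qed
      qed
      have q_eq: "q n = ((W (r n) (t + s) - W (r n) t) - (\<nu> (t + s) n - \<nu> t n)) /\<^sub>R s" for n
      proof -
        let ?c = "\<lambda>k. overlap (\<iota> (r n)) (t + s) k - overlap (\<iota> (r n)) t k"
        let ?I = "{\<iota> (r n)..<end' (\<iota> (r n))}"
        have "\<nu> (t + s) n - \<nu> t n = (\<Sum>k\<in>?I. ?c k *\<^sub>R \<zeta> k)"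
          by (simp add: \<nu>_def sum_subtractf scaleR_left_diff_distrib)
        moreover have "W (r n) (t + s) - W (r n) t = (\<Sum>k\<in>?I. ?c k *\<^sub>R u k) + (\<Sum>k\<in>?I. ?c k *\<^sub>R \<zeta> k)"
          by (simp only: W_def interp_diff scaleR_add_right sum.distrib)
        moreover have "q n = (\<Sum>k\<in>?I. ?c k *\<^sub>R u k) /\<^sub>R s"
          unfolding q_def scaleR_sum_right by (simp add: divide_inverse mult.commute)
        ultimately show ?thesis by simp
      qed
      have "q \<longlonglongrightarrow> ((w0 (t + s) - w0 t) - (0 - 0)) /\<^sub>R s"
        unfolding q_eq using t s by (intro tendsto_intros ptw \<nu>) auto
      then have q_lim: "q \<longlonglongrightarrow> (w (t + s) - w t) /\<^sub>R s"
        using t s by (simp add: w_eq)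
      have "\<forall>\<^sub>F n in sequentially. q n \<in> G"
      proof -
        have "\<forall>\<^sub>F i in sequentially. \<forall>k\<ge>i. dist (z k) (w t) < d \<longrightarrow> u k \<in> G"
          using drift by (simp add: eventually_all_ge_at_top)
        then have drift': "\<forall>\<^sub>F n in sequentially. \<forall>k\<ge>\<iota> (r n). dist (z k) (w t) < d \<longrightarrow> u k \<in> G"
          using \<iota>r by (rule eventually_compose_filterlim)
        have d4: "0 < d / 4" "0 < d / (8 * B + 8)" using d B_nonneg by auto
        show ?thesis
          using drift' unif'[OF d4(1)] small_steps[OF d4(2)]
        proof eventually_elim
          case (elim n)
          define i N where "i = \<iota> (r n)" and "N = end' i"
          define l where "l k = (overlap i (t + s) k - overlap i t k) / s" for k
          \<comment> \<open>The indices whose step interval meets \<open>[t, t + s]\<close>.\<close>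
          define I where "I = {k \<in> {i..<N}. l k \<noteq> 0}"
          have l_nonneg: "0 \<le> l k" for k using overlap_mono[of t "t + s"] s by (simp add: l_def)
          have "(\<Sum>k=i..<N. l k) = (t + s - t) / s"
            using sum_overlap[of i N t] sum_overlap[of i N "t + s"] end'[of i] t s
            by (simp add: l_def N_def sum_divide_distrib[symmetric] sum_subtractf)
          moreover have "(\<Sum>k\<in>I. l k) = (\<Sum>k=i..<N. l k)"
            by (rule sum.mono_neutral_left) (auto simp: I_def)
          ultimately have "(\<Sum>k\<in>I. l k) = 1" using s by simp
          moreover have "u k \<in> G" if k: "k \<in> I" for k
          proof -
            have differ: "overlap i (t + s) k \<noteq> overlap i t k" using k by (auto simp: I_def l_def)
            have "\<not> \<sigma> i + (t + s) \<le> \<sigma> k"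
              using differ s overlap_empty[of i "t + s" k] overlap_empty[of i t k] by auto
            then have k1: "\<sigma> k < \<sigma> i + (t + s)" by simp
            have "\<not> \<sigma> (Suc k) \<le> \<sigma> i + t"
              using differ s overlap_full[of k "Suc k" i t] overlap_full[of k "Suc k" i "t + s"] by auto
            then have k2: "\<sigma> i + t < \<sigma> k + \<eta> k" by (simp add: sigma_Suc)
            have ik: "i \<le> k" using k by (simp add: I_def)
            define t' where "t' = \<sigma> k - \<sigma> i"
            have t': "t' \<in> {0..T}" using sigma_mono[OF ik] k1 s by (simp add: t'_def)
            have \<eta>k: "\<eta> k < d / (8 * B + 8)" using elim(3) ik by (simp add: i_def)
            have "\<bar>t' - t\<bar> \<le> s + \<eta> k" using k1 k2 s step_pos[of k] by (auto simp: t'_def abs_le_iff)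
            then have "2 * B * \<bar>t' - t\<bar> \<le> 2 * B * (s + d / (8 * B + 8))"
              using B_nonneg \<eta>k by (intro mult_left_mono) auto
            also have "\<dots> = 2 * B * s + 2 * B * (d / (8 * B + 8))" by (simp add: algebra_simps)
            also have "2 * B * (d / (8 * B + 8)) \<le> d / 4" using B_nonneg d by (simp add: field_simps)
            finally have "norm (W (r n) t' - W (r n) t) \<le> d / 2"
              using W_lip[of t t' "r n"] t t' sB by simp
            moreover have "W (r n) t' = z k"
              using W_node[of "r n" k] ik k1 s by (simp add: t'_def i_def)
            moreover have "norm (W (r n) t - w0 t) < d / 4" using elim(2) t by simp
            ultimately have "dist (z k) (w t) < d"
              using norm_triangle_ineq[of "z k - W (r n) t" "W (r n) t - w0 t"] t d by (simp add: dist_norm w_eq)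
            then show ?thesis using elim(1) ik by (simp add: i_def)
          qed
          ultimately have "(\<Sum>k\<in>I. l k *\<^sub>R u k) \<in> G"
            using l_nonneg by (intro convex_sum[OF _ convex]) (auto simp: I_def)
          also have "(\<Sum>k\<in>I. l k *\<^sub>R u k) = (\<Sum>k=i..<N. l k *\<^sub>R u k)"
            by (rule sum.mono_neutral_left) (auto simp: I_def)
          finally show ?case by (simp add: q_def l_def i_def N_def)
        qed
      qed
      then have "(w (t + s) - w t) /\<^sub>R s \<in> G"
        using Lim_in_closed_set[OF closed _ sequentially_bot q_lim] by simp
      then obtain a b where ab: "(w (t + s) - w t) /\<^sub>R s = a + b" "a \<in> F (w t)" "norm b \<le> e"
        by (auto simp: G_def)
      have "norm (w (t + s) - w t - s *\<^sub>R v) \<le> e * s" using diff[of "t + s"] s by simp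
      moreover have "w (t + s) - w t = s *\<^sub>R (a + b)" using s by (simp flip: ab(1))
      ultimately have "s * norm (a + b - v) \<le> s * e"
        using s by (simp flip: scaleR_diff_right add: mult.commute)
      then have "norm (a + b - v) \<le> e" using s by simp
      then have "dist a v \<le> 2 * e"
        using ab(3) norm_triangle_ineq4[of "a + b - v" b] by (simp add: dist_norm)
      then show "\<exists>y\<in>F (w t). dist y v < e0" using ab(2) \<open>0 < e0\<close> by (intro bexI[of _ a]) (auto simp: e_def)
    qed
    then show ?thesis using closed_field[OF wt] by simp
  qed
  show ?thesis
    using that[OF r, of w] w_lip near in_closure inclusion unfolding solution_def shadows_def by blast
qed

end

section \<open>Convergence from a weak Lyapunov function\<close>

text \<open>
  Between a visit at or below \<open>c\<close> and a later one at or above \<open>b\<close>, start at the last index with value at most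
  \<open>c\<close>. As the increments vanish and the next value exceeds \<open>c\<close>, the values at these starting
  indices tend to \<open>c\<close>.
\<close>

lemma upcrossings:
  fixes v :: "nat \<Rightarrow> real"
  assumes incr: "(\<lambda>k. v (Suc k) - v k) \<longlonglongrightarrow> 0" and "c < b"
    and low: "\<exists>\<^sub>F k in sequentially. v k \<le> c" and high: "\<exists>\<^sub>F k in sequentially. b \<le> v k"
  obtains i j where "filterlim i at_top sequentially" "(\<lambda>n. v (i n)) \<longlonglongrightarrow> c"
    "\<And>n. i n < j n" "\<And>n. b \<le> v (j n)" "\<And>n k. i n \<le> k \<Longrightarrow> k \<le> j n \<Longrightarrow> v (i n) \<le> v k"
proof -
  have "\<exists>i j. n \<le> i \<and> i < j \<and> v i \<le> c \<and> b \<le> v j \<and> (\<forall>k. i < k \<longrightarrow> k \<le> j \<longrightarrow> c < v k)" for n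
  proof -
    obtain i0 where i0: "n \<le> i0" "v i0 \<le> c" using low by (auto simp: frequently_sequentially)
    obtain j where j: "i0 \<le> j" "b \<le> v j" using high by (auto simp: frequently_sequentially)
    define I where "I = {k \<in> {i0..j}. v k \<le> c}"
    have fin: "finite I" "i0 \<in> I" using i0 j by (auto simp: I_def)
    then have "Max I \<in> I" "i0 \<le> Max I" by (auto intro: Max_in Max_ge)
    moreover have "Max I \<noteq> j" using \<open>Max I \<in> I\<close> j \<open>c < b\<close> by (auto simp: I_def)
    moreover have "c < v k" if "Max I < k" "k \<le> j" for k
    proof (rule ccontr)
      assume "\<not> c < v k"
      then have "k \<in> I" using that \<open>i0 \<le> Max I\<close> by (auto simp: I_def)
      then show False using Max_ge[OF fin(1)] that by fastforce
    qed
    moreover have "n \<le> Max I" "Max I \<le> j" "v (Max I) \<le> c"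
      using i0 \<open>i0 \<le> Max I\<close> \<open>Max I \<in> I\<close> by (auto simp: I_def)
    ultimately show ?thesis using j by (metis le_neq_implies_less)
  qed
  then obtain i j where ij: "\<And>n. n \<le> i n" "\<And>n. i n < j n" "\<And>n. v (i n) \<le> c" "\<And>n. b \<le> v (j n)"
    "\<And>n k. i n < k \<Longrightarrow> k \<le> j n \<Longrightarrow> c < v k" by metis
  have i_lim: "filterlim i at_top sequentially"
    by (rule filterlim_at_top_mono[OF filterlim_ident]) (auto simp: ij)
  have "(\<lambda>n. v (i n)) \<longlonglongrightarrow> c"
  proof (rule tendsto_sandwich)
    have "(\<lambda>n. v (Suc (i n)) - v (i n)) \<longlonglongrightarrow> 0" by (rule filterlim_compose[OF incr i_lim])
    from tendsto_diff[OF tendsto_const[of c] this]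
    show "(\<lambda>n. c - (v (Suc (i n)) - v (i n))) \<longlonglongrightarrow> c" by simp
    have "c < v (Suc (i n))" for n using ij(2,5)[of n] by (auto simp: Suc_le_eq)
    then show "\<forall>\<^sub>F n in sequentially. c - (v (Suc (i n)) - v (i n)) \<le> v (i n)"
      by (auto intro!: always_eventually less_imp_le)
  qed (auto simp: ij)
  moreover have "v (i n) \<le> v k" if "i n \<le> k" "k \<le> j n" for n k
    using ij(3)[of n] ij(5)[of n k] that by (cases "i n = k") auto
  ultimately show ?thesis using that i_lim ij by blast
qed

lemma bounded_not_convergent:
  fixes v :: "nat \<Rightarrow> real"
  assumes "bounded (range v)" "\<not> convergent v"
  obtains a b where "a < b" "\<exists>\<^sub>F k in sequentially. v k \<le> a" "\<exists>\<^sub>F k in sequentially. b \<le> v k"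
proof -
  obtain l r where r: "strict_mono (r :: nat \<Rightarrow> nat)" "(v \<circ> r) \<longlonglongrightarrow> l"
    using bounded_imp_convergent_subsequence[OF assms(1)] by blast
  have near: "\<exists>\<^sub>F k in sequentially. \<bar>v k - l\<bar> < e" if "0 < e" for e
  proof -
    have "\<forall>\<^sub>F n in sequentially. \<bar>v (r n) - l\<bar> < e"
      using r(2) that by (auto simp: tendsto_iff dist_real_def)
    then have "\<exists>\<^sub>F n in sequentially. \<bar>v (r n) - l\<bar> < e"
      by (rule eventually_frequently[OF sequentially_bot])
    then show ?thesis
      using eventually_compose_filterlim[OF _ filterlim_subseq[OF r(1)], of "\<lambda>k. \<not> \<bar>v k - l\<bar> < e"]
      unfolding frequently_def by blast
  qed
  have "\<not> v \<longlonglongrightarrow> l" using assms(2) by (auto simp: convergent_def)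
  then obtain e where e: "0 < e" "\<exists>\<^sub>F k in sequentially. \<not> \<bar>v k - l\<bar> < e"
    by (auto simp: tendsto_iff dist_real_def not_eventually)
  then have "\<exists>\<^sub>F k in sequentially. v k \<le> l - e \<or> l + e \<le> v k"
    by (auto elim!: frequently_elim1)
  then consider "\<exists>\<^sub>F k in sequentially. v k \<le> l - e" | "\<exists>\<^sub>F k in sequentially. l + e \<le> v k"
    by (auto simp: frequently_disj_iff)
  then show ?thesis
  proof cases
    case 1
    have "\<exists>\<^sub>F k in sequentially. l - e / 2 \<le> v k"
      using near[OF half_gt_zero[OF e(1)]] by (rule frequently_elim1) linarith
    then show ?thesis using that[of "l - e" "l - e / 2"] 1 e(1) by simp
  next
    case 2
    have "\<exists>\<^sub>F k in sequentially. v k \<le> l + e / 2"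
      using near[OF half_gt_zero[OF e(1)]] by (rule frequently_elim1) linarith
    then show ?thesis using that[of "l + e / 2" "l + e"] 2 e(1) by simp
  qed
qed

context noisy_inclusion begin

lemma iterate_limit_in_closure:
  fixes m :: "nat \<Rightarrow> nat"
  assumes "(\<lambda>n. z (m n)) \<longlonglongrightarrow> q"
  shows "q \<in> closure (range z)"
  unfolding closure_sequential using assms by (intro exI[of _ "\<lambda>n. z (m n)"]) auto

lemma shadows_subseq:
  assumes "shadows T \<iota> w" "strict_mono s"
  shows "shadows T (\<lambda>n. \<iota> (s n)) w"
  unfolding shadows_def
proof (intro allI impI)
  fix e :: real assume "0 < e"
  then have "\<forall>\<^sub>F n in sequentially. \<forall>m\<ge>\<iota> n. \<sigma> m \<le> \<sigma> (\<iota> n) + T \<longrightarrow> dist (z m) (w (\<sigma> m - \<sigma> (\<iota> n))) < e"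
    using assms(1) by (auto simp: shadows_def)
  then show "\<forall>\<^sub>F n in sequentially. \<forall>m\<ge>\<iota> (s n). \<sigma> m \<le> \<sigma> (\<iota> (s n)) + T \<longrightarrow> dist (z m) (w (\<sigma> m - \<sigma> (\<iota> (s n)))) < e"
    using filterlim_subseq[OF assms(2)] by (rule eventually_compose_filterlim)
qed

lemma iterates_follow_curve:
  assumes w: "shadows T \<iota> w" "solution T w"
    and m: "\<And>n. \<iota> n \<le> m n" "\<And>n. \<sigma> (m n) \<le> \<sigma> (\<iota> n) + T" and t: "(\<lambda>n. \<sigma> (m n) - \<sigma> (\<iota> n)) \<longlonglongrightarrow> t"
  shows "(\<lambda>n. z (m n)) \<longlonglongrightarrow> w t"
proof -
  have "continuous_on UNIV w" using w(2) lipschitz_on_continuous_on by (auto simp: solution_def)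
  then have cont: "isCont w t" by (simp add: continuous_on_eq_continuous_at)
  have "(\<lambda>n. z (m n) - w (\<sigma> (m n) - \<sigma> (\<iota> n))) \<longlonglongrightarrow> 0"
    unfolding tendsto_iff
  proof (intro allI impI)
    fix e :: real assume "0 < e"
    then have "\<forall>\<^sub>F n in sequentially. \<forall>m\<ge>\<iota> n. \<sigma> m \<le> \<sigma> (\<iota> n) + T \<longrightarrow> dist (z m) (w (\<sigma> m - \<sigma> (\<iota> n))) < e"
      using w(1) by (auto simp: shadows_def)
    then show "\<forall>\<^sub>F n in sequentially. dist (z (m n) - w (\<sigma> (m n) - \<sigma> (\<iota> n))) 0 < e"
      by eventually_elim (use m in \<open>simp add: dist_norm\<close>)
  qed
  from tendsto_add[OF this isCont_tendsto_compose[OF cont t]] show ?thesis by simp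
qed

lemma last_index_before:
  assumes \<iota>: "filterlim \<iota> at_top sequentially" and T: "0 < T"
  obtains m where "\<forall>n. \<iota> n \<le> m n \<and> \<sigma> (m n) \<le> \<sigma> (\<iota> n) + T" "(\<lambda>n. \<sigma> (m n) - \<sigma> (\<iota> n)) \<longlonglongrightarrow> T"
    "filterlim m at_top sequentially"
proof -
  have "\<exists>m. \<iota> n \<le> m \<and> \<sigma> m \<le> \<sigma> (\<iota> n) + T \<and> \<sigma> (\<iota> n) + T < \<sigma> (Suc m)" for n
    using index_at_time[of T "\<iota> n"] T by auto
  then obtain m where m: "\<And>n. \<iota> n \<le> m n" "\<And>n. \<sigma> (m n) \<le> \<sigma> (\<iota> n) + T" "\<And>n. \<sigma> (\<iota> n) + T < \<sigma> (Suc (m n))"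
    by metis
  have m_lim: "filterlim m at_top sequentially"
    by (rule filterlim_at_top_mono[OF \<iota>]) (simp add: m)
  then have "(\<lambda>n. \<eta> (m n)) \<longlonglongrightarrow> 0" by (rule filterlim_compose[OF step_lim])
  from tendsto_diff[OF tendsto_const[of T] this] have "(\<lambda>n. T - \<eta> (m n)) \<longlonglongrightarrow> T" by simp
  then have "(\<lambda>n. \<sigma> (m n) - \<sigma> (\<iota> n)) \<longlonglongrightarrow> T"
  proof (rule tendsto_sandwich[rotated 2])
    have "T - \<eta> (m n) \<le> \<sigma> (m n) - \<sigma> (\<iota> n)" for n using m(3)[of n] sigma_Suc[of "m n"] by linarith
    then show "\<forall>\<^sub>F n in sequentially. T - \<eta> (m n) \<le> \<sigma> (m n) - \<sigma> (\<iota> n)" by simp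
    have "\<sigma> (m n) - \<sigma> (\<iota> n) \<le> T" for n using m(2)[of n] by linarith
    then show "\<forall>\<^sub>F n in sequentially. \<sigma> (m n) - \<sigma> (\<iota> n) \<le> T" by simp
  qed auto
  then show ?thesis using that m m_lim by blast
qed

text \<open>
  The time span \<open>T\<close> of the strict decrease may depend on the point \<open>p\<close>, and \<open>V\<close> may be constant for a
  while before it drops. Consider upcrossings of \<open>V\<close> from a level \<open>c\<close> outside \<open>V ` S\<close>: their starting
  points have a cluster point \<open>p\<close> with \<open>V p = c\<close>, so \<open>p \<notin> S\<close>, and a limit curve from \<open>p\<close> stays at or
  below \<open>c\<close> up to time \<open>T\<close> and is below \<open>c\<close> at time \<open>T\<close>. The first property excludes that
  upcrossings are completed within time \<open>T\<close> infinitely often, the second that they last longer, since \<open>V\<close> is at least its starting value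
  until they end.
\<close>

lemma lyapunov_convergence:
  fixes V :: "'a \<Rightarrow> real"
  assumes V: "continuous_on (closure (range z)) V"
    and image: "interior (V ` S) = {}"
    and decrease: "\<And>p. p \<in> closure (range z) - S \<Longrightarrow> \<exists>T>0. \<forall>w. solution T w \<longrightarrow> w 0 = p \<longrightarrow>
      (\<forall>t\<in>{0..T}. V (w t) \<le> V p) \<and> V (w T) < V p"
  shows "convergent (\<lambda>k. V (z k))"
    and "\<And>\<iota> p. filterlim \<iota> at_top sequentially \<Longrightarrow> (\<lambda>n. z (\<iota> n)) \<longlonglongrightarrow> p \<Longrightarrow> p \<in> S"
proof -
  define K where "K = closure (range z)"
  have zK: "z k \<in> K" for k using closure_subset[of "range z"] by (auto simp: K_def)
  have compact: "compact K" using bounded_iterates by (simp add: K_def)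
  have V_lim: "(\<lambda>n. V (z (m n))) \<longlonglongrightarrow> V q" if "(\<lambda>n. z (m n)) \<longlonglongrightarrow> q" for m :: "nat \<Rightarrow> nat" and q
    using continuous_on_tendsto_compose[OF V that iterate_limit_in_closure[OF that]] zK by (simp add: K_def)
  have descent: "\<exists>r w T. strict_mono r \<and> 0 < T \<and> solution T w \<and> shadows T (\<lambda>n. \<iota> (r n)) w \<and>
      (\<forall>t\<in>{0..T}. V (w t) \<le> V p) \<and> V (w T) < V p"
    if \<iota>: "filterlim \<iota> at_top sequentially" and p: "(\<lambda>n. z (\<iota> n)) \<longlonglongrightarrow> p" "p \<notin> S" for \<iota> :: "nat \<Rightarrow> nat" and p
  proof -
    obtain T where T: "0 < T" and dec: "\<And>w. solution T w \<Longrightarrow> w 0 = p \<Longrightarrow>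
      (\<forall>t\<in>{0..T}. V (w t) \<le> V p) \<and> V (w T) < V p"
      using decrease[of p] p(2) iterate_limit_in_closure[OF p(1)] by blast
    obtain r w where r: "strict_mono r" and w: "solution T w" "shadows T (\<lambda>n. \<iota> (r n)) w"
      using limit_curve[OF \<iota> T] by blast
    have "(\<lambda>n. z (\<iota> (r n))) \<longlonglongrightarrow> w 0"
      using iterates_follow_curve[OF w(2,1), of "\<lambda>n. \<iota> (r n)" 0] T by simp
    moreover have "(\<lambda>n. z (\<iota> (r n))) \<longlonglongrightarrow> p" using LIMSEQ_subseq_LIMSEQ[OF p(1) r] by (simp add: o_def)
    ultimately have "w 0 = p" by (rule LIMSEQ_unique)
    then show ?thesis using r T w dec[OF w(1)] by blast
  qed
  show conv: "convergent (\<lambda>k. V (z k))"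
  proof (rule ccontr)
    assume "\<not> ?thesis"
    moreover have "bounded (range (\<lambda>k. V (z k)))"
    proof (rule bounded_subset)
      show "bounded (V ` K)" using compact_continuous_image[OF V[folded K_def] compact] by (rule compact_imp_bounded)
    qed (use zK in auto)
    ultimately obtain a b where "a < b" and low: "\<exists>\<^sub>F k in sequentially. V (z k) \<le> a"
      and high: "\<exists>\<^sub>F k in sequentially. b \<le> V (z k)"
      using bounded_not_convergent[of "\<lambda>k. V (z k)"] by metis
    have "\<not> {a<..<b} \<subseteq> V ` S"
      using interior_maximal[of "{a<..<b}" "V ` S"] image \<open>a < b\<close> by auto
    then obtain c where "c \<in> {a<..<b}" and c': "c \<notin> V ` S" by blast
    then have c: "a < c" "c < b" by auto
    have low': "\<exists>\<^sub>F k in sequentially. V (z k) \<le> c" using low by (rule frequently_elim1) (use c in linarith)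
    have "(\<lambda>k. z (Suc k) - z k) \<longlonglongrightarrow> 0"
    proof (rule Lim_null_comparison)
      show "(\<lambda>k. 2 * B * \<eta> k) \<longlonglongrightarrow> 0" using step_lim by (auto intro!: tendsto_eq_intros)
      have "norm (z (Suc k) - z k) \<le> 2 * B * \<eta> k" for k
      proof -
        have "norm (u k + \<zeta> k) \<le> 2 * B"
          using norm_triangle_ineq[of "u k" "\<zeta> k"] drift_bound[of k] noise_bound[of k] by linarith
        then show ?thesis using step_pos[of k] by (simp add: step mult.commute mult_left_mono)
      qed
      then show "\<forall>\<^sub>F k in sequentially. norm (z (Suc k) - z k) \<le> 2 * B * \<eta> k" by simp
    qed
    moreover have "uniformly_continuous_on K V"
      using compact_uniformly_continuous[OF _ compact] V by (simp add: K_def)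
    ultimately have incr: "(\<lambda>k. V (z (Suc k)) - V (z k)) \<longlonglongrightarrow> 0"
      using zK unfolding uniformly_continuous_on_sequentially by (auto simp: dist_norm tendsto_norm_zero_iff tendsto_rabs_zero_iff)
    obtain i j where i: "filterlim i at_top sequentially" and vi: "(\<lambda>n. V (z (i n))) \<longlonglongrightarrow> c"
      and ij: "\<And>n. i n < j n" and vj: "\<And>n. b \<le> V (z (j n))"
      and above: "\<And>n k. i n \<le> k \<Longrightarrow> k \<le> j n \<Longrightarrow> V (z (i n)) \<le> V (z k)"
      using upcrossings[OF incr c(2) low' high] by metis
    obtain p r0 where r0: "strict_mono (r0 :: nat \<Rightarrow> nat)" and "((\<lambda>n. z (i n)) \<circ> r0) \<longlonglongrightarrow> p"
      using seq_compactE[OF compact_imp_seq_compact[OF compact], of "\<lambda>n. z (i n)"] zK by blast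
    then have p: "(\<lambda>n. z (i (r0 n))) \<longlonglongrightarrow> p" by (simp add: o_def)
    have i0: "filterlim (\<lambda>n. i (r0 n)) at_top sequentially"
      by (rule filterlim_compose[OF i filterlim_subseq[OF r0]])
    have "(\<lambda>n. V (z (i (r0 n)))) \<longlonglongrightarrow> c" using LIMSEQ_subseq_LIMSEQ[OF vi r0] by (simp add: o_def)
    then have Vp: "V p = c" using V_lim[OF p] LIMSEQ_unique by blast
    then have "p \<notin> S" using c' by auto
    from descent[OF i0 p this] obtain r w T where r: "strict_mono r" and T: "0 < T"
      and w: "solution T w" and shadows: "shadows T (\<lambda>n. i (r0 (r n))) w"
      and le: "\<And>t. t \<in> {0..T} \<Longrightarrow> V (w t) \<le> c" and less: "V (w T) < c"
      unfolding Vp by blast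
    define \<iota> where "\<iota> n = i (r0 (r n))" for n
    define \<kappa> where "\<kappa> n = j (r0 (r n))" for n
    have \<iota>: "filterlim \<iota> at_top sequentially"
      unfolding \<iota>_def by (rule filterlim_compose[OF i0 filterlim_subseq[OF r]])
    have \<iota>\<kappa>: "\<iota> n \<le> \<kappa> n" for n using ij[of "r0 (r n)"] by (simp add: \<iota>_def \<kappa>_def)
    have v\<iota>: "(\<lambda>n. V (z (\<iota> n))) \<longlonglongrightarrow> c"
      using filterlim_compose[OF vi, of "\<lambda>n. r0 (r n)"] filterlim_compose[OF filterlim_subseq[OF r0] filterlim_subseq[OF r]]
      by (simp add: \<iota>_def)
    show False
    proof (cases "\<exists>\<^sub>F n in sequentially. \<sigma> (\<kappa> n) \<le> \<sigma> (\<iota> n) + T")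
      case True
      then have "infinite {n. \<sigma> (\<kappa> n) \<le> \<sigma> (\<iota> n) + T}"
        by (simp add: frequently_cofinite flip: cofinite_eq_sequentially)
      then obtain s1 where s1: "strict_mono (s1 :: nat \<Rightarrow> nat)" "\<And>n. \<sigma> (\<kappa> (s1 n)) \<le> \<sigma> (\<iota> (s1 n)) + T"
        using infinite_enumerate[of "{n. \<sigma> (\<kappa> n) \<le> \<sigma> (\<iota> n) + T}"] by auto
      have in_window: "\<sigma> (\<kappa> (s1 n)) - \<sigma> (\<iota> (s1 n)) \<in> {0..T}" for n
        using s1(2)[of n] sigma_mono[OF \<iota>\<kappa>[of "s1 n"]] by simp
      obtain t s2 where t: "t \<in> {0..T}" and s2: "strict_mono (s2 :: nat \<Rightarrow> nat)"
        and lim: "((\<lambda>n. \<sigma> (\<kappa> (s1 n)) - \<sigma> (\<iota> (s1 n))) \<circ> s2) \<longlonglongrightarrow> t"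
        by (rule seq_compactE[OF compact_imp_seq_compact[OF compact_Icc[of 0 T]],
              of "\<lambda>n. \<sigma> (\<kappa> (s1 n)) - \<sigma> (\<iota> (s1 n))"]) (use in_window in blast)+
      have "(\<lambda>n. z (\<kappa> (s1 (s2 n)))) \<longlonglongrightarrow> w t"
      proof (rule iterates_follow_curve[OF _ w])
        show "shadows T (\<lambda>n. \<iota> (s1 (s2 n))) w"
          using shadows_subseq[OF shadows_subseq[OF shadows s1(1)] s2] by (simp add: \<iota>_def)
      qed (use lim s1(2) \<iota>\<kappa> in \<open>auto simp: o_def\<close>)
      then have "b \<le> V (w t)"
        using V_lim vj by (intro tendsto_lowerbound[of "\<lambda>n. V (z (\<kappa> (s1 (s2 n))))" _ sequentially]) (simp_all add: \<kappa>_def)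
      then show False using le[OF t] c(2) by simp
    next
      case False
      obtain m where m: "\<forall>n. \<iota> n \<le> m n \<and> \<sigma> (m n) \<le> \<sigma> (\<iota> n) + T" "(\<lambda>n. \<sigma> (m n) - \<sigma> (\<iota> n)) \<longlonglongrightarrow> T"
        "filterlim m at_top sequentially"
        by (rule last_index_before[OF \<iota> T])
      have "(\<lambda>n. z (m n)) \<longlonglongrightarrow> w T"
        using iterates_follow_curve[OF shadows w] m by (simp add: \<iota>_def)
      then have "(\<lambda>n. V (z (m n))) \<longlonglongrightarrow> V (w T)" by (rule V_lim)
      moreover have "\<forall>\<^sub>F n in sequentially. V (z (\<iota> n)) \<le> V (z (m n))"
        using False unfolding not_frequently
      proof eventually_elim
        case (elim n)
        then have "\<sigma> (m n) < \<sigma> (\<kappa> n)" using m(1) by (smt (verit))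
        then have "m n \<le> \<kappa> n" using sigma_mono[of "\<kappa> n" "m n"] by (meson linorder_not_less nat_le_linear)
        then show ?case using above[of "r0 (r n)" "m n"] m(1) by (simp add: \<iota>_def \<kappa>_def)
      qed
      ultimately have "c \<le> V (w T)" using v\<iota> by (intro tendsto_le[OF sequentially_bot])
      then show False using less by simp
    qed
  qed
  show "p \<in> S" if \<iota>: "filterlim \<iota> at_top sequentially" and p: "(\<lambda>n. z (\<iota> n)) \<longlonglongrightarrow> p" for \<iota> p
  proof (rule ccontr)
    assume "p \<notin> S"
    from descent[OF \<iota> p this] obtain r w T where r: "strict_mono r" and T: "0 < T" and less: "V (w T) < V p"
      and w: "shadows T (\<lambda>n. \<iota> (r n)) w" "solution T w"
      by blast
    have \<iota>r: "filterlim (\<lambda>n. \<iota> (r n)) at_top sequentially"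
      by (rule filterlim_compose[OF \<iota> filterlim_subseq[OF r]])
    obtain m where m: "\<forall>n. \<iota> (r n) \<le> m n \<and> \<sigma> (m n) \<le> \<sigma> (\<iota> (r n)) + T"
      "(\<lambda>n. \<sigma> (m n) - \<sigma> (\<iota> (r n))) \<longlonglongrightarrow> T" and m_lim: "filterlim m at_top sequentially"
      by (rule last_index_before[OF \<iota>r T])
    have lim: "(\<lambda>n. V (z (m n))) \<longlonglongrightarrow> V (w T)"
      using m(1) by (intro V_lim[OF iterates_follow_curve[OF w _ _ m(2)]]) auto
    obtain l where l: "(\<lambda>k. V (z k)) \<longlonglongrightarrow> l" using conv by (auto simp: convergent_def)
    have "V (w T) = l" using LIMSEQ_unique[OF lim] filterlim_compose[OF l m_lim] by blast
    moreover have "V p = l" using LIMSEQ_unique[OF V_lim[OF p]] filterlim_compose[OF l \<iota>] by blast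
    ultimately show False using less by simp
  qed
qed

end

section \<open>The momentum flow and its Lyapunov function\<close>

text \<open>
  The differential inclusion followed by the method, on pairs \<open>(x, y)\<close> of primal and auxiliary
  variable.
\<close>

locale momentum_flow =
  fixes X :: "(real^'n) set" and \<tau> \<alpha> :: real and h :: "real^'n \<Rightarrow> real" and D :: "real^'n \<Rightarrow> (real^'n) set"
  assumes closed_X: "closed X" and convex_X: "convex X" and X_ne: "X \<noteq> {}"
    and tau_pos: "0 < \<tau>" and alpha_pos: "0 < \<alpha>"
    and conservative: "conservative_field h D" and convex_D: "convex (D x)"
begin

abbreviation P :: "real^'n \<Rightarrow> real^'n" where "P \<equiv> closest_point X"

definition vel :: "(real^'n) \<times> (real^'n) \<Rightarrow> real^'n" where
  "vel q = P (fst q - \<alpha> *\<^sub>R snd q) - fst q"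

definition field :: "(real^'n) \<times> (real^'n) \<Rightarrow> ((real^'n) \<times> (real^'n)) set" where
  "field q = {vel q} \<times> ((\<lambda>d. - (\<tau> *\<^sub>R (snd q - d))) ` D (fst q))"

text \<open>
  This is \<open>h - m / \<tau>\<close> for \<open>m (x, y) = min {\<langle>y, z - x\<rangle> + \<parallel>z - x\<parallel>\<^sup>2 / (2 \<alpha>) | z \<in> X}\<close>. Completing the
  square turns \<open>m\<close> into a squared distance to \<open>X\<close> minus \<open>\<alpha> \<parallel>y\<parallel>\<^sup>2 / 2\<close>, which makes its
  differentiability a property of the distance.
\<close>

definition V :: "(real^'n) \<times> (real^'n) \<Rightarrow> real" where
  "V q = h (fst q) + (\<alpha> / 2 * (norm (snd q))\<^sup>2
     - (norm (fst q - \<alpha> *\<^sub>R snd q - P (fst q - \<alpha> *\<^sub>R snd q)))\<^sup>2 / (2 * \<alpha>)) / \<tau>"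

text \<open>
  The choice serves two purposes: \<open>V = h\<close> on this set, so that the values of \<open>V\<close> there are critical
  values of \<open>h\<close>, and every flow that starts outside it loses \<open>V\<close> strictly. The true rest points form
  a smaller set, the one with \<open>y \<in> D x\<close> in addition.
\<close>

definition equilibria :: "((real^'n) \<times> (real^'n)) set" where
  "equilibria = {q. fst q \<in> crit X D \<and> vel q = 0}"

lemma V_equilibrium: "vel q = 0 \<Longrightarrow> V q = h (fst q)"
  using alpha_pos by (simp add: vel_def V_def power_mult_distrib power2_eq_square)

lemma interior_V_equilibria: "interior (h ` crit X D) = {} \<Longrightarrow> interior (V ` equilibria) = {}"
proof -
  assume *: "interior (h ` crit X D) = {}"
  have "V ` equilibria \<subseteq> h ` crit X D" by (auto simp: equilibria_def V_equilibrium)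
  then show ?thesis using interior_mono * by blast
qed

lemma compact_D: "compact (D x)"
  using conservative_field_bounded_on_compact[OF conservative, of "{x}"] conservative_field_closed_value[OF conservative]
  by (simp add: compact_eq_bounded_closed)

lemma D_nonempty: "D x \<noteq> {}"
  using conservative by (simp add: conservative_field_def)

lemma closed_field: "closed (field q)" and convex_field: "convex (field q)"
proof -
  have img: "(\<lambda>d. - (\<tau> *\<^sub>R (snd q - d))) ` D (fst q) = (\<lambda>d. (- \<tau> *\<^sub>R snd q) + d) ` ((\<lambda>d. \<tau> *\<^sub>R d) ` D (fst q))"
    by (auto simp: image_image algebra_simps)
  have "compact ((\<lambda>d. - (\<tau> *\<^sub>R (snd q - d))) ` D (fst q))"
    unfolding img by (intro compact_translation compact_scaling compact_D)
  then show "closed (field q)" unfolding field_def by (intro closed_Times) (auto intro: compact_imp_closed)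
  have "convex ((\<lambda>d. - (\<tau> *\<^sub>R (snd q - d))) ` D (fst q))"
    unfolding img by (intro convex_translation convex_scaling convex_D)
  then show "convex (field q)" unfolding field_def by (intro convex_Times) auto
qed

lemma P_lipschitz: "norm (P u - P v) \<le> norm (u - v)"
  using closest_point_lipschitz[OF convex_X closed_X X_ne, of u v] by (simp add: dist_norm)

lemma continuous_vel: "continuous_on S vel"
proof -
  have P: "continuous_on UNIV P" using continuous_on_closest_point[OF convex_X closed_X X_ne] .
  have "continuous_on S (\<lambda>q. P (fst q - \<alpha> *\<^sub>R snd q))"
    by (rule continuous_on_compose2[OF P]) (auto intro!: continuous_intros)
  then show ?thesis unfolding vel_def by (intro continuous_intros)
qed

lemma calm_V: "calm_at V q"
proof -
  have fst: "calm_at fst q" by (rule calm_at_has_derivative) (auto intro!: derivative_eq_intros)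
  have "calm_at h (fst q)"
    using conservative by (auto simp: conservative_field_def intro: locally_lipschitz_calm_at)
  from calm_at_compose[OF fst this] have h: "calm_at (\<lambda>q. h (fst q)) q" .
  define E where "E q = fst q - \<alpha> *\<^sub>R snd q" for q :: "(real^'n) \<times> (real^'n)"
  have "(E has_derivative (\<lambda>v. fst v - \<alpha> *\<^sub>R snd v)) (at q)"
    unfolding E_def by (auto intro!: derivative_eq_intros)
  from has_derivative_compose[OF this sqdist_has_derivative[OF closed_X convex_X X_ne]]
  have "((\<lambda>q. (norm (E q - P (E q)))\<^sup>2) has_derivative
      (\<lambda>v. 2 * ((E q - P (E q)) \<bullet> (fst v - \<alpha> *\<^sub>R snd v)))) (at q)" .
  moreover have "((\<lambda>q. (norm (snd q))\<^sup>2) has_derivative (\<lambda>v. snd q \<bullet> snd v + snd v \<bullet> snd q)) (at q)"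
    unfolding power2_norm_eq_inner by (intro has_derivative_inner has_derivative_snd has_derivative_ident)
  ultimately have "((\<lambda>q. (\<alpha> / 2 * (norm (snd q))\<^sup>2 - (norm (E q - P (E q)))\<^sup>2 / (2 * \<alpha>)) / \<tau>) has_derivative
      (\<lambda>v. (\<alpha> / 2 * (snd q \<bullet> snd v + snd v \<bullet> snd q) - (2 * ((E q - P (E q)) \<bullet> (fst v - \<alpha> *\<^sub>R snd v))) / (2 * \<alpha>)) / \<tau>)) (at q)"
    unfolding divide_inverse by (intro has_derivative_mult_left has_derivative_mult_right has_derivative_diff)
  from calm_at_add[OF h calm_at_has_derivative[OF this]]
  show ?thesis unfolding V_def E_def by simp
qed

lemma continuous_V: "continuous_on S V"
  using calm_at_tendsto[OF calm_V]
  by (intro continuous_at_imp_continuous_on) (simp add: isCont_def tendsto_at_iff_tendsto_nhds)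

text \<open>
  Write \<open>p\<close> for the velocity of \<open>x\<close>. Substituting \<open>d = y + v / \<tau>\<close>, the terms with \<open>p \<bullet> v\<close> and
  \<open>y \<bullet> v\<close> cancel and leave \<open>V' = (1 + 1 / \<tau>) (y \<bullet> p) + \<parallel>p\<parallel>\<^sup>2 / (\<alpha> \<tau>)\<close>. The variational inequality of
  the projection, tested at \<open>x \<in> X\<close>, says \<open>y \<bullet> p \<le> - \<parallel>p\<parallel>\<^sup>2 / \<alpha>\<close>.
\<close>

lemma V_derivative:
  assumes x: "(x has_vector_derivative vel (x t, y t)) (at t)"
    and y: "(y has_vector_derivative v) (at t)" and v: "v = - (\<tau> *\<^sub>R (y t - d))"
    and h: "((\<lambda>s. h (x s)) has_real_derivative d \<bullet> vel (x t, y t)) (at t)"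
    and X: "x t \<in> X"
  obtains V' where "((\<lambda>s. V (x s, y s)) has_real_derivative V') (at t)" "V' \<le> - (norm (vel (x t, y t)))\<^sup>2 / \<alpha>"
proof -
  define p where "p = vel (x t, y t)"
  define E where "E s = x s - \<alpha> *\<^sub>R y s" for s
  have E: "(E has_vector_derivative (p - \<alpha> *\<^sub>R v)) (at t)"
    unfolding E_def using x y by (auto intro!: derivative_eq_intros simp: p_def)
  have "((\<lambda>s. (norm (E s - P (E s)))\<^sup>2) has_derivative (\<lambda>s. 2 * ((E t - P (E t)) \<bullet> (s *\<^sub>R (p - \<alpha> *\<^sub>R v))))) (at t)"
    using has_derivative_compose[OF E[unfolded has_vector_derivative_def] sqdist_has_derivative[OF closed_X convex_X X_ne]] .
  then have sq: "((\<lambda>s. (norm (E s - P (E s)))\<^sup>2) has_real_derivative 2 * ((E t - P (E t)) \<bullet> (p - \<alpha> *\<^sub>R v))) (at t)"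
    unfolding has_field_derivative_def by (rule has_derivative_eq_rhs) (simp add: fun_eq_iff)
  have "((\<lambda>s. y s \<bullet> y s) has_vector_derivative (y t \<bullet> v + v \<bullet> y t)) (at t)"
    by (rule bounded_bilinear.has_vector_derivative[OF bounded_bilinear_inner y y])
  then have ysq: "((\<lambda>s. (norm (y s))\<^sup>2) has_real_derivative 2 * (y t \<bullet> v)) (at t)"
    by (simp add: power2_norm_eq_inner has_real_derivative_iff_has_vector_derivative inner_commute)
  define V' where "V' = d \<bullet> p + (\<alpha> / 2 * (2 * (y t \<bullet> v)) - 2 * ((E t - P (E t)) \<bullet> (p - \<alpha> *\<^sub>R v)) / (2 * \<alpha>)) / \<tau>"
  have deriv: "((\<lambda>s. V (x s, y s)) has_real_derivative V') (at t)"
    unfolding V_def V'_def fst_conv snd_conv E_def[symmetric]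
    by (intro DERIV_add DERIV_cdivide DERIV_diff DERIV_cmult sq ysq h[folded p_def])
  have PE: "E t - P (E t) = - (\<alpha> *\<^sub>R y t) - p" by (simp add: p_def vel_def E_def)
  have opt: "(E t - P (E t)) \<bullet> (x t - P (E t)) \<le> 0"
    using closest_point_dot[OF convex_X closed_X X] .
  have "x t - P (E t) = - p" by (simp add: p_def vel_def E_def)
  with opt PE have "(- (\<alpha> *\<^sub>R y t) - p) \<bullet> (- p) \<le> 0" by simp
  then have opt: "\<alpha> * (y t \<bullet> p) + p \<bullet> p \<le> 0" by (simp add: inner_diff_left)
  have d: "d = y t + (1 / \<tau>) *\<^sub>R v" using tau_pos by (simp add: v)
  have "V' = (1 + 1 / \<tau>) * (y t \<bullet> p) + (p \<bullet> p) / (\<alpha> * \<tau>)"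
    unfolding V'_def PE d using tau_pos alpha_pos
    by (simp add: inner_diff_left inner_diff_right inner_add_left inner_add_right inner_commute field_simps)
  also have "\<dots> \<le> (1 + 1 / \<tau>) * (- (p \<bullet> p) / \<alpha>) + (p \<bullet> p) / (\<alpha> * \<tau>)"
    using opt alpha_pos tau_pos by (intro add_right_mono mult_left_mono) (auto simp: field_simps)
  also have "\<dots> = - (norm p)\<^sup>2 / \<alpha>"
    using alpha_pos tau_pos by (simp add: field_simps power2_norm_eq_inner)
  finally show ?thesis using that deriv by (simp add: p_def)
qed

text \<open>
  The Lipschitz condition is imposed on the whole line because the chain rule of a conservative
  field speaks of curves on the half-line.
\<close>

definition flow_on :: "real \<Rightarrow> (real \<Rightarrow> (real^'n) \<times> (real^'n)) \<Rightarrow> bool" where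
  "flow_on T w \<longleftrightarrow> (\<exists>L. L-lipschitz_on UNIV w) \<and> (\<forall>t\<in>{0..T}. fst (w t) \<in> X) \<and>
     (\<forall>t\<in>{0<..<T}. \<forall>v. (w has_vector_derivative v) (at t) \<longrightarrow> v \<in> field (w t))"

lemma flow_on_components:
  assumes "flow_on T w"
  obtains L where "L-lipschitz_on UNIV (\<lambda>t. fst (w t))" "L-lipschitz_on UNIV (\<lambda>t. snd (w t))"
proof -
  obtain L where L: "L-lipschitz_on UNIV w" using assms by (auto simp: flow_on_def)
  have "dist (fst (w s)) (fst (w t)) \<le> L * dist s t" "dist (snd (w s)) (snd (w t)) \<le> L * dist s t" for s t
    using lipschitz_onD[OF L, of s t] dist_fst_le[of "w s" "w t"] dist_snd_le[of "w s" "w t"] by auto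
  then show ?thesis using lipschitz_on_nonneg[OF L] by (intro that[of L] lipschitz_onI) auto
qed

text \<open>
  Applying the chain rule to both components shows that \<open>w\<close> is differentiable almost everywhere.
  The inclusion then names the element \<open>d\<close> of \<open>D\<close> that also governs the derivative of \<open>h\<close>.
\<close>

lemma flow_velocity:
  assumes w: "flow_on T w"
  obtains S where "negligible S" "\<And>t. t \<in> {0<..<T} - S \<Longrightarrow> \<exists>d\<in>D (fst (w t)).
    ((\<lambda>s. fst (w s)) has_vector_derivative vel (w t)) (at t) \<and>
    ((\<lambda>s. snd (w s)) has_vector_derivative - (\<tau> *\<^sub>R (snd (w t) - d))) (at t) \<and>
    ((\<lambda>s. h (fst (w s))) has_real_derivative d \<bullet> vel (w t)) (at t)"
proof -
  obtain L where L: "L-lipschitz_on UNIV (\<lambda>t. fst (w t))" "L-lipschitz_on UNIV (\<lambda>t. snd (w t))"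
    using flow_on_components[OF w] .
  obtain S1 where S1: "negligible S1" "\<And>t. 0 \<le> t \<Longrightarrow> t \<notin> S1 \<Longrightarrow> \<exists>v. ((\<lambda>t. fst (w t)) has_vector_derivative v) (at t) \<and>
      (\<forall>d\<in>D (fst (w t)). ((h \<circ> (\<lambda>t. fst (w t))) has_real_derivative (d \<bullet> v)) (at t))"
    using conservative_field_chain_rule[OF conservative L(1)] by metis
  obtain S2 where S2: "negligible S2" "\<And>t. 0 \<le> t \<Longrightarrow> t \<notin> S2 \<Longrightarrow> \<exists>v. ((\<lambda>t. snd (w t)) has_vector_derivative v) (at t) \<and>
      (\<forall>d\<in>D (snd (w t)). ((h \<circ> (\<lambda>t. snd (w t))) has_real_derivative (d \<bullet> v)) (at t))"
    using conservative_field_chain_rule[OF conservative L(2)] by metis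
  show ?thesis
  proof
    show "negligible (S1 \<union> S2)" using S1 S2 by (simp add: negligible_Un)
    fix t assume t: "t \<in> {0<..<T} - (S1 \<union> S2)"
    obtain v1 where v1: "((\<lambda>t. fst (w t)) has_vector_derivative v1) (at t)"
      "\<And>d. d \<in> D (fst (w t)) \<Longrightarrow> ((h \<circ> (\<lambda>t. fst (w t))) has_real_derivative (d \<bullet> v1)) (at t)"
      using S1(2)[of t] t by auto
    obtain v2 where v2: "((\<lambda>t. snd (w t)) has_vector_derivative v2) (at t)"
      using S2(2)[of t] t by auto
    have "(w has_vector_derivative (v1, v2)) (at t)"
      using has_vector_derivative_Pair[OF v1(1) v2] by simp
    then have "(v1, v2) \<in> field (w t)" using w t by (auto simp: flow_on_def)
    then obtain d where d: "d \<in> D (fst (w t))" "v1 = vel (w t)" "v2 = - (\<tau> *\<^sub>R (snd (w t) - d))"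
      by (auto simp: field_def)
    show "\<exists>d\<in>D (fst (w t)).
      ((\<lambda>s. fst (w s)) has_vector_derivative vel (w t)) (at t) \<and>
      ((\<lambda>s. snd (w s)) has_vector_derivative - (\<tau> *\<^sub>R (snd (w t) - d))) (at t) \<and>
      ((\<lambda>s. h (fst (w s))) has_real_derivative d \<bullet> vel (w t)) (at t)"
      using v1 v2 d by (intro bexI[of _ d]) (auto simp: o_def)
  qed
qed

text \<open>
  Integrating \<open>V' \<le> - \<parallel>x'\<parallel>\<^sup>2 / \<alpha>\<close>: if nothing is lost over \<open>[0, t]\<close>, the integral of the continuous
  function \<open>\<parallel>vel (w s)\<parallel>\<^sup>2\<close> is zero, so the function vanishes.
\<close>

lemma flow_decrease:
  assumes w: "flow_on T w" and t: "0 \<le> t" "t \<le> T"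
  shows "V (w t) \<le> V (w 0)"
    and "V (w 0) \<le> V (w t) \<Longrightarrow> s \<in> {0..t} \<Longrightarrow> 0 < t \<Longrightarrow> vel (w s) = 0"
proof -
  obtain L where L: "L-lipschitz_on UNIV w" using w by (auto simp: flow_on_def)
  obtain S where S: "negligible S" and S': "\<And>t. t \<in> {0<..<T} - S \<Longrightarrow> \<exists>d\<in>D (fst (w t)).
    ((\<lambda>s. fst (w s)) has_vector_derivative vel (w t)) (at t) \<and>
    ((\<lambda>s. snd (w s)) has_vector_derivative - (\<tau> *\<^sub>R (snd (w t) - d))) (at t) \<and>
    ((\<lambda>s. h (fst (w s))) has_real_derivative d \<bullet> vel (w t)) (at t)"
    using flow_velocity[OF w] by metis
  define q where "q s = (norm (vel (w s)))\<^sup>2 / \<alpha>" for s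
  have cw: "continuous_on A w" for A
    using lipschitz_on_continuous_on[OF L] continuous_on_subset by blast
  have "continuous_on A (\<lambda>s. vel (w s))" for A
    by (rule continuous_on_compose2[OF continuous_vel cw]) auto
  then have cq: "continuous_on {0..t} q"
    unfolding q_def using alpha_pos by (intro continuous_intros) auto
  define I where "I = integral {0..t} q"
  have I: "(q has_integral I) {0..t}"
    unfolding I_def using cq by (intro integrable_integral integrable_continuous_interval)
  have "V (w t) - V (w 0) \<le> - I"
  proof (rule increment_bound[OF t(1) S])
    show "calm_at (\<lambda>s. V (w s)) s" for s
      using calm_at_compose[OF calm_at_lipschitz[OF L open_UNIV UNIV_I] calm_V] .
    show "((\<lambda>s. - q s) has_integral - I) {0..t}" using I by (rule has_integral_neg)
    fix s assume s: "s \<in> {0<..<t} - S"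
    obtain d where d: "((\<lambda>s. fst (w s)) has_vector_derivative vel (w s)) (at s)"
      "((\<lambda>s. snd (w s)) has_vector_derivative - (\<tau> *\<^sub>R (snd (w s) - d))) (at s)"
      "((\<lambda>s. h (fst (w s))) has_real_derivative d \<bullet> vel (w s)) (at s)"
      using S'[of s] s t by auto
    obtain V' where "((\<lambda>s. V (fst (w s), snd (w s))) has_real_derivative V') (at s)"
      "V' \<le> - (norm (vel (fst (w s), snd (w s))))\<^sup>2 / \<alpha>"
    proof (rule V_derivative[of "\<lambda>s. fst (w s)" s "\<lambda>s. snd (w s)"])
      show "fst (w s) \<in> X" using w s t by (auto simp: flow_on_def)
    qed (use d in auto)
    then show "\<exists>V'. ((\<lambda>s. V (w s)) has_real_derivative V') (at s) \<and> V' \<le> - q s"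
      by (auto simp: q_def)
  qed
  moreover have q_nonneg: "0 \<le> q s" for s using alpha_pos by (simp add: q_def)
  moreover have "0 \<le> I" using I q_nonneg by (intro has_integral_nonneg[OF I]) auto
  ultimately show "V (w t) \<le> V (w 0)" by simp
  assume "V (w 0) \<le> V (w t)" and s: "s \<in> {0..t}" "0 < t"
  with \<open>V (w t) - V (w 0) \<le> - I\<close> \<open>0 \<le> I\<close> have "I = 0" by simp
  have "q s = 0"
    by (rule has_integral_0_cbox_imp_0[of 0 t q]) (use cq I \<open>I = 0\<close> q_nonneg s in auto)
  then show "vel (w s) = 0" using alpha_pos by (simp add: q_def)
qed

text \<open>
  A flow with vanishing \<open>vel\<close> keeps \<open>x\<close> at \<open>x0\<close> and \<open>- y\<close> in the normal cone at \<open>x0\<close>. Since \<open>x0\<close> is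
  not critical, a linear functional \<open>a\<close> separates the set \<open>N\<close> of such \<open>y\<close> from \<open>D x0\<close>, so \<open>a \<bullet> y\<close>
  grows at a rate of at least \<open>c > 0\<close>. A bounded \<open>y\<close> does not allow this beyond time \<open>2 \<parallel>a\<parallel> M / c\<close>.
\<close>

lemma stationary_flow_time_bound:
  assumes x0: "x0 \<in> X" "x0 \<notin> crit X D"
  obtains T where "0 < T"
    "\<And>w. flow_on T w \<Longrightarrow> fst (w 0) = x0 \<Longrightarrow> (\<And>t. t \<in> {0..T} \<Longrightarrow> vel (w t) = 0 \<and> norm (snd (w t)) \<le> M) \<Longrightarrow> False"
proof -
  define N where "N = {y. - y \<in> normal_cone X x0}"
  have N_alt: "N = (\<Inter>z\<in>X. {y. 0 \<le> (z - x0) \<bullet> y})"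
    by (auto simp: N_def normal_cone_def inner_commute)
  have "closed N" "convex N"
    unfolding N_alt by (intro closed_INT convex_INT ballI closed_halfspace_ge convex_halfspace_ge)+
  moreover have "N \<inter> D x0 = {}"
  proof (rule ccontr)
    assume "\<not> ?thesis"
    then obtain d where d: "d \<in> D x0" "- d \<in> normal_cone X x0" by (auto simp: N_def)
    then have "0 \<in> {d + v | d v. d \<in> D x0 \<and> v \<in> normal_cone X x0}"
      by (intro CollectI exI[of _ d] exI[of _ "- d"]) simp
    then show False using x0 by (simp add: crit_def)
  qed
  ultimately obtain a b where a: "\<forall>y\<in>N. a \<bullet> y < b" and b: "\<forall>d\<in>D x0. b < a \<bullet> d"
    using separating_hyperplane_closed_compact[OF _ _ convex_D compact_D D_nonempty, of N x0] by blast
  obtain d0 where d0: "d0 \<in> D x0" "\<And>d. d \<in> D x0 \<Longrightarrow> a \<bullet> d0 \<le> a \<bullet> d"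
    using continuous_attains_inf[OF compact_D D_nonempty continuous_on_inner[OF continuous_on_const continuous_on_id], of x0 a]
    by blast
  define c where "c = \<tau> * (a \<bullet> d0 - b)"
  have c: "0 < c" using b d0 tau_pos by (simp add: c_def)
  define T where "T = (2 * norm a * \<bar>M\<bar> + 1) / c"
  have T: "0 < T" using c by (simp add: T_def add_nonneg_pos)
  show ?thesis
  proof (rule that[OF T])
    fix w assume w: "flow_on T w" and w0: "fst (w 0) = x0"
      and rest: "\<And>t. t \<in> {0..T} \<Longrightarrow> vel (w t) = 0 \<and> norm (snd (w t)) \<le> M"
    obtain L where L: "L-lipschitz_on UNIV (\<lambda>t. fst (w t))" "L-lipschitz_on UNIV (\<lambda>t. snd (w t))"
      using flow_on_components[OF w] .
    obtain S where S: "negligible S" and S': "\<And>t. t \<in> {0<..<T} - S \<Longrightarrow> \<exists>d\<in>D (fst (w t)).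
      ((\<lambda>s. fst (w s)) has_vector_derivative vel (w t)) (at t) \<and>
      ((\<lambda>s. snd (w s)) has_vector_derivative - (\<tau> *\<^sub>R (snd (w t) - d))) (at t) \<and>
      ((\<lambda>s. h (fst (w s))) has_real_derivative d \<bullet> vel (w t)) (at t)"
      using flow_velocity[OF w] by metis
    have const: "fst (w t) = x0" if t: "t \<in> {0..T}" for t
    proof -
      have N: "negligible (S \<union> {0, t})" using S by simp
      have "((\<lambda>_. 0) has_integral (fst (w t) - fst (w 0))) {0..t}"
      proof (rule fundamental_theorem_of_calculus_negligible[OF _ N])
        fix s assume s: "s \<in> {0..t} - (S \<union> {0, t})"
        then have "((\<lambda>s. fst (w s)) has_vector_derivative vel (w s)) (at s)" "vel (w s) = 0"
          using S'[of s] rest[of s] t by auto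
        then show "((\<lambda>s. fst (w s)) has_vector_derivative 0) (at s within {0..t})"
          by (simp add: has_vector_derivative_at_within)
      qed (use t calm_at_lipschitz[OF L(1)] in auto)
      from has_integral_unique[OF this has_integral_0] show ?thesis by (simp add: w0)
    qed
    have y_N: "snd (w t) \<in> N" if t: "t \<in> {0..T}" for t
    proof -
      have P: "P (x0 - \<alpha> *\<^sub>R snd (w t)) = x0" using rest[OF t] const[OF t] by (simp add: vel_def)
      have "- snd (w t) \<bullet> (z - x0) \<le> 0" if "z \<in> X" for z
        using closest_point_dot[OF convex_X closed_X that, of "x0 - \<alpha> *\<^sub>R snd (w t)"] alpha_pos
        by (simp add: P mult_le_0_iff zero_le_mult_iff)
      then show ?thesis by (simp add: N_def normal_cone_def)
    qed
    have "(\<lambda>t. - (a \<bullet> snd (w t))) T - (\<lambda>t. - (a \<bullet> snd (w t))) 0 \<le> - c * T"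
    proof (rule increment_bound[OF less_imp_le[OF T] S])
      fix t
      have "calm_at (\<lambda>y. - (a \<bullet> y)) (snd (w t))"
        by (rule calm_at_has_derivative) (auto intro!: derivative_eq_intros)
      then show "calm_at (\<lambda>t. - (a \<bullet> snd (w t))) t"
        using calm_at_compose[OF calm_at_lipschitz[OF L(2) open_UNIV UNIV_I]] by blast
    next
      show "((\<lambda>_. - c) has_integral - c * T) {0..T}"
        using has_integral_const_real[of "- c" 0 T] T by (simp add: mult.commute)
      fix t assume t: "t \<in> {0<..<T} - S"
      then obtain d where d: "d \<in> D (fst (w t))"
        "((\<lambda>s. snd (w s)) has_vector_derivative - (\<tau> *\<^sub>R (snd (w t) - d))) (at t)"
        using S' by blast
      have "((\<lambda>s. - (a \<bullet> snd (w s))) has_vector_derivative - (a \<bullet> - (\<tau> *\<^sub>R (snd (w t) - d)))) (at t)"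
        using d(2) by (intro has_vector_derivative_minus bounded_linear.has_vector_derivative[OF bounded_linear_inner_right])
      moreover have "c \<le> \<tau> * (a \<bullet> d - a \<bullet> snd (w t))"
      proof -
        have "a \<bullet> d0 \<le> a \<bullet> d" using d0(2) d(1) const[of t] t by simp
        moreover have "a \<bullet> snd (w t) < b" using a y_N[of t] t by simp
        ultimately show ?thesis unfolding c_def using tau_pos by (intro mult_left_mono) auto
      qed
      ultimately show "\<exists>f'. ((\<lambda>s. - (a \<bullet> snd (w s))) has_real_derivative f') (at t) \<and> f' \<le> - c"
        unfolding has_real_derivative_iff_has_vector_derivative
        by (intro exI conjI) (auto simp: inner_diff_right algebra_simps)
    qed
    then have "c * T \<le> a \<bullet> snd (w T) - a \<bullet> snd (w 0)" by simp
    also have "\<dots> \<le> norm a * \<bar>M\<bar> + norm a * \<bar>M\<bar>"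
    proof -
      have "\<bar>a \<bullet> snd (w t)\<bar> \<le> norm a * \<bar>M\<bar>" if "t \<in> {0..T}" for t
      proof -
        have "\<bar>a \<bullet> snd (w t)\<bar> \<le> norm a * norm (snd (w t))" by (rule Cauchy_Schwarz_ineq2)
        also have "\<dots> \<le> norm a * \<bar>M\<bar>" using rest[OF that] by (intro mult_left_mono) auto
        finally show ?thesis .
      qed
      from this[of 0] this[of T] T have "\<bar>a \<bullet> snd (w 0)\<bar> \<le> norm a * \<bar>M\<bar>" "\<bar>a \<bullet> snd (w T)\<bar> \<le> norm a * \<bar>M\<bar>"
        by simp_all
      then show ?thesis by linarith
    qed
    finally show False using c by (simp add: T_def)
  qed
qed

lemma flow_strict_decrease:
  assumes p: "fst p \<in> X" "p \<notin> equilibria"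
  shows "\<exists>T>0. \<forall>w. flow_on T w \<longrightarrow> w 0 = p \<longrightarrow> (\<forall>t\<in>{0..T}. norm (snd (w t)) \<le> M) \<longrightarrow>
    (\<forall>t\<in>{0..T}. V (w t) \<le> V p) \<and> V (w T) < V p"
proof (cases "fst p \<in> crit X D")
  case True
  then have "vel p \<noteq> 0" using p by (simp add: equilibria_def)
  then have "V (w 1) < V (w 0)" if "flow_on 1 w" "w 0 = p" for w
    using flow_decrease(2)[OF that(1), of 1 0] that(2) by (metis atLeastAtMost_iff linorder_not_less order_refl zero_le_one zero_less_one)
  then show ?thesis using flow_decrease(1) by (intro exI[of _ 1]) auto
next
  case False
  obtain T where T: "0 < T" and bound: "\<And>w. flow_on T w \<Longrightarrow> fst (w 0) = fst p \<Longrightarrow>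
      (\<And>t. t \<in> {0..T} \<Longrightarrow> vel (w t) = 0 \<and> norm (snd (w t)) \<le> M) \<Longrightarrow> False"
    using stationary_flow_time_bound[OF p(1) False] by metis
  have "V (w T) < V (w 0)" if w: "flow_on T w" "w 0 = p" "\<forall>t\<in>{0..T}. norm (snd (w t)) \<le> M" for w
  proof (rule ccontr)
    assume "\<not> ?thesis"
    then have "vel (w t) = 0" if "t \<in> {0..T}" for t using flow_decrease(2)[OF w(1), of T t] that T by auto
    then show False using bound[OF w(1)] w(2,3) by auto
  qed
  then show ?thesis using flow_decrease(1) T by (intro exI[of _ T]) auto
qed

end

section \<open>Displacement of the proximal momentum step\<close>

lemma locally_bounded_on_continuous:
  fixes f :: "'a::heine_borel \<Rightarrow> real"
  assumes "continuous_on UNIV f"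
  shows "locally_bounded_on S f"
  unfolding locally_bounded_on_def
proof
  fix p
  have "bounded (f ` cball p 1)"
    using continuous_on_subset[OF assms] by (intro compact_imp_bounded compact_continuous_image) auto
  then have "bounded (f ` (ball p 1 \<inter> S))"
    by (rule bounded_subset) (auto simp: less_imp_le)
  then show "\<exists>U. open U \<and> p \<in> U \<and> bounded (f ` (U \<inter> S))"
    by (intro exI[of _ "ball p 1"]) simp
qed

lemma dist_Pair_le: "dist (a, b) (c, d) \<le> dist a c + dist b d"
  unfolding dist_Pair_Pair by (rule sqrt_sum_squares_le_sum) auto

lemma Phi_S_displacement:
  fixes X :: "(real^'n) set"
  assumes X: "closed X" "convex X" and "x \<in> X" "0 \<le> \<tau>" "0 \<le> \<eta>"
    and R: "norm (closest_point X (x - \<alpha> *\<^sub>R (y - (\<tau> * \<eta>) *\<^sub>R (y - g))) - x) \<le> R"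
  shows "Phi_S X \<tau> \<alpha> k g x y \<eta> \<noteq> {}" "infdist (x, y) (Phi_S X \<tau> \<alpha> k g x y \<eta>) \<le> \<eta> * (R + \<tau> * norm (y - g))"
proof -
  show "Phi_S X \<tau> \<alpha> k g x y \<eta> \<noteq> {}" by (simp add: Phi_S_def)
  define p where "p = closest_point X (x - \<alpha> *\<^sub>R (y - (\<tau> * \<eta>) *\<^sub>R (y - g))) - x"
  have "X \<noteq> {}" using assms by auto
  then have "Phi_S X \<tau> \<alpha> k g x y \<eta> = {(x + \<eta> *\<^sub>R p, y - (\<tau> * \<eta>) *\<^sub>R (y - g))}"
    using X by (simp add: Phi_S_def prox_eq_closest_point p_def algebra_simps)
  then have "infdist (x, y) (Phi_S X \<tau> \<alpha> k g x y \<eta>) \<le> dist x (x + \<eta> *\<^sub>R p) + dist y (y - (\<tau> * \<eta>) *\<^sub>R (y - g))"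
    by (simp only: infdist_singleton dist_Pair_le)
  also have "\<dots> = \<eta> * norm p + \<tau> * \<eta> * norm (y - g)" using assms by (simp add: dist_norm)
  also have "\<dots> \<le> \<eta> * R + \<tau> * \<eta> * norm (y - g)" using R assms by (intro add_right_mono mult_left_mono) (auto simp: p_def)
  finally show "infdist (x, y) (Phi_S X \<tau> \<alpha> k g x y \<eta>) \<le> \<eta> * (R + \<tau> * norm (y - g))"
    by (simp add: algebra_simps)
qed

lemma embeddable_displacement_Phi_S_bounded_steps:
  fixes X :: "(real^'n) set"
  assumes X: "closed X" "convex X" and pos: "0 < \<tau>" "0 < \<alpha>"
  shows "embeddable_displacement X {0..\<eta>max} (Phi_S X \<tau> \<alpha>)"
proof -
  define T where "T = (\<lambda>(g :: real^'n, x :: real^'n, y).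
    \<alpha> * (norm y + \<tau> * \<bar>\<eta>max\<bar> * norm (y - g)) + \<tau> * norm (y - g))"
  have "continuous_on UNIV T" unfolding T_def split_beta by (intro continuous_intros)
  then have "locally_bounded_on (UNIV \<times> X \<times> UNIV) T" by (rule locally_bounded_on_continuous)
  moreover have "0 \<le> T (g, x, y)" for g x y using pos by (simp add: T_def)
  moreover have "Phi_S X \<tau> \<alpha> k g x y \<eta> \<noteq> {} \<and> infdist (x, y) (Phi_S X \<tau> \<alpha> k g x y \<eta>) \<le> \<eta> * T (g, x, y)"
    if x: "x \<in> X" and \<eta>: "\<eta> \<in> {0..\<eta>max}" for g x y \<eta> k
  proof -
    have "norm (closest_point X (x - \<alpha> *\<^sub>R (y - (\<tau> * \<eta>) *\<^sub>R (y - g))) - x) \<le> \<alpha> * norm (y - (\<tau> * \<eta>) *\<^sub>R (y - g))"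
      using norm_projected_step_le[OF X x, of "\<alpha> *\<^sub>R (y - (\<tau> * \<eta>) *\<^sub>R (y - g))"] pos by simp
    also have "\<dots> \<le> \<alpha> * (norm y + \<tau> * \<bar>\<eta>max\<bar> * norm (y - g))"
    proof (rule mult_left_mono)
      have "norm (y - (\<tau> * \<eta>) *\<^sub>R (y - g)) \<le> norm y + norm ((\<tau> * \<eta>) *\<^sub>R (y - g))"
        by (rule norm_triangle_ineq4)
      also have "norm ((\<tau> * \<eta>) *\<^sub>R (y - g)) \<le> \<tau> * \<bar>\<eta>max\<bar> * norm (y - g)"
        using pos \<eta> by (auto intro!: mult_right_mono mult_left_mono)
      finally show "norm (y - (\<tau> * \<eta>) *\<^sub>R (y - g)) \<le> norm y + \<tau> * \<bar>\<eta>max\<bar> * norm (y - g)" by simp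
    qed (use pos in simp)
    finally show ?thesis
      using Phi_S_displacement[OF X x, of \<tau> \<eta> \<alpha> y g] pos \<eta> by (simp add: T_def)
  qed
  ultimately show ?thesis unfolding embeddable_displacement_def by blast
qed

lemma embeddable_displacement_Phi_S_bounded_set:
  fixes X :: "(real^'n) set"
  assumes X: "closed X" "convex X" and bdd: "bounded X" and pos: "0 < \<tau>"
  shows "embeddable_displacement X {0..} (Phi_S X \<tau> \<alpha>)"
proof -
  define T where "T = (\<lambda>(g :: real^'n, x :: real^'n, y). diameter X + \<tau> * norm (y - g))"
  have "continuous_on UNIV T" unfolding T_def split_beta by (intro continuous_intros)
  then have "locally_bounded_on (UNIV \<times> X \<times> UNIV) T" by (rule locally_bounded_on_continuous)
  moreover have "0 \<le> T (g, x, y)" for g x y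
    using pos diameter_ge_0[OF bdd] by (simp add: T_def)
  moreover have "Phi_S X \<tau> \<alpha> k g x y \<eta> \<noteq> {} \<and> infdist (x, y) (Phi_S X \<tau> \<alpha> k g x y \<eta>) \<le> \<eta> * T (g, x, y)"
    if x: "x \<in> X" and \<eta>: "\<eta> \<in> {0..}" for g x y \<eta> k
  proof -
    have "closest_point X u \<in> X" for u using closest_point_in_set[OF X(1)] x by blast
    then have "norm (closest_point X (x - \<alpha> *\<^sub>R (y - (\<tau> * \<eta>) *\<^sub>R (y - g))) - x) \<le> diameter X"
      using diameter_bounded_bound[OF bdd _ x] by (simp add: dist_norm)
    then show ?thesis
      using Phi_S_displacement[OF X x, of \<tau> \<eta> \<alpha> y g "diameter X"] pos \<eta> by (simp add: T_def)
  qed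
  ultimately show ?thesis unfolding embeddable_displacement_def by blast
qed

section \<open>Convergence of the proximal momentum iterates\<close>

text \<open>
  The supremum of natural numbers in \<open>step_index\<close> is a maximum because the step sums diverge, so
  every \<open>j\<close> in question is among the indices over which the noise is controlled.
\<close>

lemma vanishing_noise_partial_sums:
  fixes \<xi> :: "nat \<Rightarrow> real^'n"
  assumes noise: "vanishing_noise \<eta> \<xi>" and pos: "\<And>k. 0 < \<eta> k"
    and div: "filterlim (step_sum \<eta>) at_top sequentially" and "0 < T" "0 < e"
  shows "\<forall>\<^sub>F i in sequentially. \<forall>j\<ge>i. step_sum \<eta> j \<le> step_sum \<eta> i + T \<longrightarrow>
    norm (\<Sum>k=i..j. \<eta> k *\<^sub>R \<xi> (Suc k)) \<le> e"
proof -
  let ?n = "\<lambda>i j. norm (\<Sum>k=i..j. \<eta> k *\<^sub>R \<xi> (Suc k))"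
  have "\<forall>\<^sub>F i in sequentially. (SUP j\<in>{i..step_index \<eta> (step_sum \<eta> i + T)}. ?n i j) < e"
    using noise assms(4,5) by (auto simp: vanishing_noise_def dest: order_tendstoD(2))
  then show ?thesis
  proof eventually_elim
    case (elim i)
    show ?case
    proof (intro allI impI)
      fix j assume j: "i \<le> j" "step_sum \<eta> j \<le> step_sum \<eta> i + T"
      have "\<forall>\<^sub>F n in sequentially. step_sum \<eta> i + T < step_sum \<eta> n"
        using div by (simp add: filterlim_at_top_dense)
      then obtain N where N: "\<And>n. N \<le> n \<Longrightarrow> step_sum \<eta> i + T < step_sum \<eta> n"
        by (auto simp: eventually_sequentially)
      have "bdd_above {k. step_sum \<eta> k \<le> step_sum \<eta> i + T}"
      proof (rule bdd_aboveI)
        fix k assume "k \<in> {k. step_sum \<eta> k \<le> step_sum \<eta> i + T}"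
        then show "k \<le> N" using N[of k] by (cases "N \<le> k") auto
      qed
      then have "j \<le> step_index \<eta> (step_sum \<eta> i + T)"
        unfolding step_index_def using j by (intro cSup_upper) auto
      then have "?n i j \<le> (SUP j\<in>{i..step_index \<eta> (step_sum \<eta> i + T)}. ?n i j)"
        using j by (intro cSUP_upper) auto
      then show "?n i j \<le> e" using elim by simp
    qed
  qed
qed

text \<open>
  The iterates form a noisy recursion for the momentum flow with noise \<open>(0, \<tau> \<xi>)\<close>. The proximal
  step uses \<open>y (Suc k)\<close> instead of \<open>y k\<close> and the subgradient is taken at a point near \<open>x k\<close>; both
  discrepancies vanish and are absorbed into the condition that the drift approaches the field.
\<close>

lemma embeddable_convergence_Phi_S:
  fixes X :: "(real^'n) set"
  assumes X: "closed X" "convex X" and pos: "0 < \<tau>" "0 < \<alpha>"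
  shows "embeddable_convergence X (Phi_S X \<tau> \<alpha>)"
  unfolding embeddable_convergence_def
proof (intro allI impI, elim conjE)
  fix h :: "real^'n \<Rightarrow> real" and D x y g \<eta> \<delta> \<xi>
  assume cf: "conservative_field h D" and convex: "\<forall>z. convex (D z)"
    and iter: "\<forall>k. (x (Suc k), y (Suc k)) \<in> Phi_S X \<tau> \<alpha> k (g k) (x k) (y k) (\<eta> k)"
    and sard: "interior (h ` crit X D) = {}" and xX: "\<forall>k. x k \<in> X"
    and bdd: "bounded (range (\<lambda>k. (x k, y k)))"
    and \<delta>0: "\<forall>k. 0 \<le> \<delta> k" and \<delta>_lim: "\<delta> \<longlonglongrightarrow> 0"
    and estimate: "\<forall>k. g k \<in> {w + \<xi> (Suc k) |w. w \<in> expansion D (\<delta> k) (x k)}"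
    and \<eta>_pos: "\<forall>k. 0 < \<eta> k" and \<eta>_lim: "\<eta> \<longlonglongrightarrow> 0" and \<eta>_div: "filterlim (step_sum \<eta>) at_top sequentially"
    and \<xi>_bdd: "bounded (range \<xi>)" and noise: "vanishing_noise \<eta> \<xi>"
  interpret momentum_flow X \<tau> \<alpha> h D
    by unfold_locales (use X pos cf convex xX in auto)
  define z where "z k = (x k, y k)" for k
  define w where "w k = g k - \<xi> (Suc k)" for k
  define u where "u k = (P (x k - \<alpha> *\<^sub>R y (Suc k)) - x k, - (\<tau> *\<^sub>R (y k - w k)))" for k
  define \<zeta> where "\<zeta> k = (0 :: real^'n, \<tau> *\<^sub>R \<xi> (Suc k))" for k
  have y_Suc: "y (Suc k) = y k - (\<tau> * \<eta> k) *\<^sub>R (y k - g k)" for k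
    using iter[rule_format, of k] by (simp add: Phi_S_def)
  have x_Suc: "x (Suc k) = (1 - \<eta> k) *\<^sub>R x k + \<eta> k *\<^sub>R P (x k - \<alpha> *\<^sub>R y (Suc k))" for k
    using iter[rule_format, of k] by (simp add: Phi_S_def y_Suc prox_eq_closest_point[OF X X_ne])
  have step: "z (Suc k) = z k + \<eta> k *\<^sub>R (u k + \<zeta> k)" for k
    by (simp add: z_def u_def \<zeta>_def x_Suc) (simp add: y_Suc w_def algebra_simps)
  have "\<exists>v d. norm (v - x k) \<le> \<delta> k \<and> d \<in> D v \<and> norm (w k - d) \<le> \<delta> k" for k
  proof -
    have "w k \<in> expansion D (\<delta> k) (x k)" using estimate[rule_format, of k] by (auto simp: w_def)
    then show ?thesis using expansion_witness[OF cf] by metis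
  qed
  then obtain v d where v: "\<And>k. norm (v k - x k) \<le> \<delta> k" and d: "\<And>k. d k \<in> D (v k)"
    and wd: "\<And>k. norm (w k - d k) \<le> \<delta> k" by metis
  obtain M where M: "\<And>k. norm (z k) \<le> M" using bdd by (auto simp: bounded_iff z_def)
  have xM: "norm (x k) \<le> M" and yM: "norm (y k) \<le> M" for k
    using M[of k] norm_fst_le[of "x k" "y k"] norm_snd_le[of "y k" "x k"] by (auto simp: z_def)
  obtain \<Delta> where \<Delta>: "\<And>k. \<delta> k \<le> \<Delta>"
    using convergent_imp_bounded[OF \<delta>_lim] by (auto simp: bounded_iff intro: order_trans[OF abs_ge_self])
  obtain R where R: "\<And>z d. norm z \<le> M + \<Delta> \<Longrightarrow> d \<in> D z \<Longrightarrow> norm d \<le> R"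
  proof -
    obtain R where "\<forall>d\<in>(\<Union>z\<in>cball 0 (M + \<Delta>). D z). norm d \<le> R"
      using conservative_field_bounded_on_compact[OF cf compact_cball[of 0 "M + \<Delta>"]] unfolding bounded_iff ..
    then show ?thesis by (intro that[of R]) auto
  qed
  obtain \<Xi> where \<Xi>: "\<And>k. norm (\<xi> k) \<le> \<Xi>" using \<xi>_bdd by (auto simp: bounded_iff)
  have wR: "norm (w k) \<le> R + \<Delta>" for k
  proof -
    have "norm (v k) \<le> M + \<Delta>" using v[of k] xM[of k] \<Delta>[of k] norm_triangle_sub[of "v k" "x k"] by linarith
    then show ?thesis using R[OF _ d[of k]] wd[of k] \<Delta>[of k] norm_triangle_sub[of "w k" "d k"] by linarith
  qed
  define B where "B = \<alpha> * M + \<tau> * (M + (R + \<Delta>)) + \<tau> * \<Xi>"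
  have M0: "0 \<le> M" and R0: "0 \<le> R + \<Delta>" and \<Xi>0: "0 \<le> \<Xi>"
    using xM wR \<Xi> norm_ge_zero order_trans by blast+
  have uB: "norm (u k) \<le> B" for k
  proof -
    have "norm (P (x k - \<alpha> *\<^sub>R y (Suc k)) - x k) \<le> \<alpha> * norm (y (Suc k))"
      using norm_projected_step_le[OF X xX[rule_format], of k "\<alpha> *\<^sub>R y (Suc k)"] pos by simp
    also have "\<dots> \<le> \<alpha> * M" using yM pos by (intro mult_left_mono) auto
    finally have 1: "norm (P (x k - \<alpha> *\<^sub>R y (Suc k)) - x k) \<le> \<alpha> * M" .
    have "norm (y k - w k) \<le> M + (R + \<Delta>)"
      using norm_triangle_ineq4[of "y k" "w k"] yM[of k] wR[of k] by linarith
    then have "norm (- (\<tau> *\<^sub>R (y k - w k))) \<le> \<tau> * (M + (R + \<Delta>))" using pos by simp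
    moreover have "norm (u k) \<le> norm (P (x k - \<alpha> *\<^sub>R y (Suc k)) - x k) + norm (- (\<tau> *\<^sub>R (y k - w k)))"
      unfolding u_def by (rule norm_Pair_le)
    moreover have "0 \<le> \<tau> * \<Xi>" using \<Xi>0 pos by simp
    ultimately show ?thesis using 1 by (simp add: B_def)
  qed
  have \<zeta>B: "norm (\<zeta> k) \<le> B" for k
  proof -
    have "norm (\<zeta> k) \<le> \<tau> * \<Xi>" using \<Xi>[of "Suc k"] pos by (simp add: \<zeta>_def norm_Pair)
    moreover have "0 \<le> \<alpha> * M + \<tau> * (M + (R + \<Delta>))" using M0 R0 pos by simp
    ultimately show ?thesis by (simp add: B_def)
  qed
  have B0: "0 \<le> B" using uB[of 0] norm_ge_zero order_trans by blast
  have closure_X: "fst p \<in> X" and closure_M: "norm (snd p) \<le> M" if "p \<in> closure (range z)" for p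
  proof -
    have "closed (X \<times> cball (0 :: real^'n) M)" using X(1) by (intro closed_Times) auto
    moreover have "range z \<subseteq> X \<times> cball 0 M" using xX yM by (auto simp: z_def)
    ultimately have "closure (range z) \<subseteq> X \<times> cball 0 M" by (rule closure_minimal[rotated])
    then show "fst p \<in> X" "norm (snd p) \<le> M" using that by auto
  qed
  interpret noisy_inclusion z u \<zeta> \<eta> field B
  proof
    show "\<forall>\<^sub>F i in sequentially. \<forall>j\<ge>i. step_sum \<eta> j \<le> step_sum \<eta> i + T \<longrightarrow> norm (\<Sum>k=i..j. \<eta> k *\<^sub>R \<zeta> k) \<le> e"
      if "0 < T" "0 < e" for T e
    proof -
      have "norm (\<Sum>k=i..j. \<eta> k *\<^sub>R \<zeta> k) = \<tau> * norm (\<Sum>k=i..j. \<eta> k *\<^sub>R \<xi> (Suc k))" for i j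
      proof -
        have "(\<Sum>k=i..j. \<eta> k *\<^sub>R \<zeta> k) = (0, \<tau> *\<^sub>R (\<Sum>k=i..j. \<eta> k *\<^sub>R \<xi> (Suc k)))"
          by (simp add: \<zeta>_def prod_eq_iff fst_sum snd_sum scaleR_sum_right mult.commute)
        then show ?thesis using pos by (simp add: norm_Pair)
      qed
      moreover have "\<forall>\<^sub>F i in sequentially. \<forall>j\<ge>i. step_sum \<eta> j \<le> step_sum \<eta> i + T \<longrightarrow>
          norm (\<Sum>k=i..j. \<eta> k *\<^sub>R \<xi> (Suc k)) \<le> e / \<tau>"
        using that pos \<eta>_pos by (intro vanishing_noise_partial_sums[OF noise _ \<eta>_div]) auto
      ultimately show ?thesis using pos by (simp add: pos_le_divide_eq mult.commute)
    qed
    show "\<exists>r>0. \<forall>\<^sub>F k in sequentially. dist (z k) p < r \<longrightarrow> u k \<in> {a + b |a b. a \<in> field p \<and> b \<in> cball 0 e}"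
      if p: "p \<in> closure (range z)" and e: "0 < e" for p e
    proof -
      \<comment> \<open>The first component of the drift is off by at most \<open>2 c + 2 \<alpha> c\<close>, the second by at most \<open>3 \<tau> c\<close>.\<close>
      define c where "c = e / (2 + 2 * \<alpha> + 3 * \<tau>)"
      have den: "0 < 2 + 2 * \<alpha> + 3 * \<tau>" using pos by simp
      have c: "0 < c" "c * (2 + 2 * \<alpha> + 3 * \<tau>) = e" using e den by (auto simp: c_def)
      obtain \<rho> where \<rho>: "0 < \<rho>" "\<And>q d. dist q (fst p) < \<rho> \<Longrightarrow> d \<in> D q \<Longrightarrow> \<exists>d'\<in>D (fst p). dist d d' < c"
        using conservative_field_upper_semicontinuous[OF cf c(1), of "fst p"] by metis
      have \<delta>_small: "\<forall>\<^sub>F k in sequentially. \<delta> k < min c (\<rho> / 2)"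
        using \<delta>_lim c \<rho> by (intro order_tendstoD(2)) auto
      have "\<forall>\<^sub>F k in sequentially. \<eta> k < c / (2 * B + 1)"
        using \<eta>_lim c B0 by (intro order_tendstoD(2) divide_pos_pos) auto
      then have "\<forall>\<^sub>F k in sequentially. dist (z k) p < min c (\<rho> / 2) \<longrightarrow> u k \<in> {a + b |a b. a \<in> field p \<and> b \<in> cball 0 e}"
        using \<delta>_small
      proof eventually_elim
        case (elim k)
        show ?case
        proof
          assume near: "dist (z k) p < min c (\<rho> / 2)"
          have xk: "norm (x k - fst p) < c" "norm (x k - fst p) < \<rho> / 2" and yk: "norm (y k - snd p) < c"
            using near dist_fst_le[of "z k" p] dist_snd_le[of "z k" p] by (auto simp: z_def dist_norm)
          have "dist (v k) (fst p) < \<rho>"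
            using v[of k] xk elim(2) norm_triangle_ineq[of "v k - x k" "x k - fst p"] by (simp add: dist_norm)
          then obtain d' where d': "d' \<in> D (fst p)" "dist (d k) d' < c" using \<rho>(2)[OF _ d] by blast
          have w_near: "norm (w k - d') \<le> 2 * c"
            using wd[of k] d'(2) elim(2) norm_triangle_ineq[of "w k - d k" "d k - d'"] by (simp add: dist_norm)
          have "norm (y (Suc k) - y k) \<le> norm (z (Suc k) - z k)"
            by (simp add: z_def norm_snd_le)
          also have "\<dots> = \<eta> k * norm (u k + \<zeta> k)" using \<eta>_pos[rule_format, of k] by (simp add: step)
          also have "\<dots> \<le> \<eta> k * (2 * B + 1)"
            using norm_triangle_ineq[of "u k" "\<zeta> k"] uB[of k] \<zeta>B[of k] \<eta>_pos[rule_format, of k]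
            by (intro mult_left_mono) auto
          also have "\<dots> \<le> c" using elim(1) B0 by (simp add: pos_less_divide_eq)
          finally have y_near: "norm (y (Suc k) - snd p) \<le> 2 * c"
            using norm_triangle_ineq[of "y (Suc k) - y k" "y k - snd p"] yk by simp
          define a where "a = (vel p, - (\<tau> *\<^sub>R (snd p - d')))"
          have a: "a \<in> field p" using d' by (auto simp: a_def field_def)
          have "norm (fst (u k - a)) \<le> 2 * c + \<alpha> * (2 * c)"
          proof -
            have "norm (P (x k - \<alpha> *\<^sub>R y (Suc k)) - P (fst p - \<alpha> *\<^sub>R snd p))
                \<le> norm ((x k - \<alpha> *\<^sub>R y (Suc k)) - (fst p - \<alpha> *\<^sub>R snd p))" by (rule P_lipschitz)
            also have "\<dots> = norm ((x k - fst p) - \<alpha> *\<^sub>R (y (Suc k) - snd p))" by (simp add: algebra_simps)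
            also have "\<dots> \<le> norm (x k - fst p) + \<alpha> * norm (y (Suc k) - snd p)"
              using norm_triangle_ineq4[of "x k - fst p" "\<alpha> *\<^sub>R (y (Suc k) - snd p)"] pos by simp
            also have "\<dots> \<le> c + \<alpha> * (2 * c)" using xk y_near pos by (intro add_mono mult_left_mono) auto
            finally have "norm (P (x k - \<alpha> *\<^sub>R y (Suc k)) - P (fst p - \<alpha> *\<^sub>R snd p)) \<le> c + \<alpha> * (2 * c)" .
            moreover have "fst (u k - a) = (P (x k - \<alpha> *\<^sub>R y (Suc k)) - P (fst p - \<alpha> *\<^sub>R snd p)) - (x k - fst p)"
              by (simp add: u_def a_def vel_def)
            ultimately show ?thesis
              using norm_triangle_ineq4[of "P (x k - \<alpha> *\<^sub>R y (Suc k)) - P (fst p - \<alpha> *\<^sub>R snd p)" "x k - fst p"] xk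
              by simp
          qed
          moreover have "norm (snd (u k - a)) \<le> \<tau> * (3 * c)"
          proof -
            have "snd (u k - a) = \<tau> *\<^sub>R ((w k - d') - (y k - snd p))" by (simp add: u_def a_def algebra_simps)
            moreover have "norm ((w k - d') - (y k - snd p)) \<le> 3 * c"
              using norm_triangle_ineq4[of "w k - d'" "y k - snd p"] w_near yk by simp
            ultimately show ?thesis using pos by simp
          qed
          moreover have "norm (u k - a) \<le> norm (fst (u k - a)) + norm (snd (u k - a))"
            using norm_Pair_le[of "fst (u k - a)" "snd (u k - a)"] by (simp only: prod.collapse)
          ultimately have "norm (u k - a) \<le> (2 * c + \<alpha> * (2 * c)) + \<tau> * (3 * c)" by linarith
          also have "\<dots> = e" using c(2) by (simp add: algebra_simps)
          finally have "u k - a \<in> cball 0 e" by simp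
          with a show "u k \<in> {a + b |a b. a \<in> field p \<and> b \<in> cball 0 e}"
            by (intro CollectI exI[of _ a] exI[of _ "u k - a"]) simp
        qed
      qed
      then show ?thesis using c \<rho> by (intro exI[of _ "min c (\<rho> / 2)"]) auto
    qed
  qed (use step \<eta>_pos \<eta>_lim \<eta>_div bdd uB \<zeta>B closed_field convex_field in \<open>auto simp: z_def\<close>)
  have decrease: "\<exists>T>0. \<forall>w. solution T w \<longrightarrow> w 0 = p \<longrightarrow> (\<forall>t\<in>{0..T}. V (w t) \<le> V p) \<and> V (w T) < V p"
    if p: "p \<in> closure (range z) - equilibria" for p
  proof -
    obtain T where T: "0 < T" and dec: "\<And>w. flow_on T w \<Longrightarrow> w 0 = p \<Longrightarrow> \<forall>t\<in>{0..T}. norm (snd (w t)) \<le> M \<Longrightarrow>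
        (\<forall>t\<in>{0..T}. V (w t) \<le> V p) \<and> V (w T) < V p"
      using flow_strict_decrease[of p M] closure_X p by blast
    have "flow_on T w \<and> (\<forall>t\<in>{0..T}. norm (snd (w t)) \<le> M)" if "solution T w" for w
      using that closure_X closure_M unfolding solution_def flow_on_def by blast
    then show ?thesis using T dec by blast
  qed
  note conv = lyapunov_convergence(1)[OF continuous_V interior_V_equilibria[OF sard] decrease]
  note limit = lyapunov_convergence(2)[OF continuous_V interior_V_equilibria[OF sard] decrease]
  have subseq: "\<exists>s q. strict_mono (s :: nat \<Rightarrow> nat) \<and> (\<lambda>n. z (r (s n))) \<longlonglongrightarrow> q \<and> q \<in> equilibria" if r: "strict_mono r" for r :: "nat \<Rightarrow> nat"
  proof -
    have "bounded (range (\<lambda>n. z (r n)))" using bounded_iterates by (rule bounded_subset) auto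
    then obtain q s where s: "strict_mono s" "((\<lambda>n. z (r n)) \<circ> s) \<longlonglongrightarrow> q"
      using bounded_imp_convergent_subsequence by metis
    then have q: "(\<lambda>n. z (r (s n))) \<longlonglongrightarrow> q" by (simp add: o_def)
    have "filterlim (\<lambda>n. r (s n)) at_top sequentially"
      by (rule filterlim_compose[OF filterlim_subseq[OF r] filterlim_subseq[OF s(1)]])
    from limit[OF _ this q] s(1) q show ?thesis by blast
  qed
  have "p \<in> crit X D" if cluster: "cluster_point x p" for p
  proof -
    obtain r where r: "strict_mono (r :: nat \<Rightarrow> nat)" "(x \<circ> r) \<longlonglongrightarrow> p" using cluster by (auto simp: cluster_point_def)
    obtain s q where s: "strict_mono (s :: nat \<Rightarrow> nat)" "(\<lambda>n. z (r (s n))) \<longlonglongrightarrow> q" "q \<in> equilibria" using subseq[OF r(1)] by blast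
    have "(\<lambda>n. x (r (s n))) \<longlonglongrightarrow> fst q" using tendsto_fst[OF s(2)] by (simp add: z_def)
    moreover have "(\<lambda>n. x (r (s n))) \<longlonglongrightarrow> p" using LIMSEQ_subseq_LIMSEQ[OF r(2) s(1)] by (simp add: o_def)
    ultimately have "p = fst q" using LIMSEQ_unique by blast
    then show ?thesis using s(3) by (simp add: equilibria_def)
  qed
  moreover have "convergent (\<lambda>k. h (x k))"
  proof -
    obtain l where l: "(\<lambda>k. V (z k)) \<longlonglongrightarrow> l" using conv by (auto simp: convergent_def)
    \<comment> \<open>Every subsequence of the iterates has a further one tending to an equilibrium, where \<open>V = h\<close>.\<close>
    have "(\<lambda>k. h (x k)) \<longlonglongrightarrow> l"
    proof (rule ccontr)
      assume "\<not> ?thesis"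
      then obtain e where e: "0 < e" "\<exists>\<^sub>F k in sequentially. \<not> dist (h (x k)) l < e"
        by (auto simp: tendsto_iff not_eventually)
      then have "infinite {k. \<not> dist (h (x k)) l < e}"
        by (simp add: frequently_cofinite flip: cofinite_eq_sequentially)
      then obtain r where r: "strict_mono (r :: nat \<Rightarrow> nat)" "\<And>n. \<not> dist (h (x (r n))) l < e"
        using infinite_enumerate[of "{k. \<not> dist (h (x k)) l < e}"] by auto
      obtain s q where s: "strict_mono (s :: nat \<Rightarrow> nat)" "(\<lambda>n. z (r (s n))) \<longlonglongrightarrow> q" "q \<in> equilibria" using subseq[OF r(1)] by blast
      have rs: "filterlim (\<lambda>n. r (s n)) at_top sequentially"
        by (rule filterlim_compose[OF filterlim_subseq[OF r(1)] filterlim_subseq[OF s(1)]])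
      have "(\<lambda>n. V (z (r (s n)))) \<longlonglongrightarrow> V q"
        by (rule continuous_on_tendsto_compose[OF continuous_V[of UNIV] s(2)]) auto
      moreover have "(\<lambda>n. V (z (r (s n)))) \<longlonglongrightarrow> l" by (rule filterlim_compose[OF l rs])
      ultimately have "h (fst q) = l"
        using LIMSEQ_unique V_equilibrium[of q] s(3) by (auto simp: equilibria_def)
      moreover have "(\<lambda>n. h (x (r (s n)))) \<longlonglongrightarrow> h (fst q)"
      proof -
        have "calm_at h (fst q)"
          using cf by (auto simp: conservative_field_def intro: locally_lipschitz_calm_at)
        moreover have "(\<lambda>n. x (r (s n))) \<longlonglongrightarrow> fst q" using tendsto_fst[OF s(2)] by (simp add: z_def)
        ultimately show ?thesis using filterlim_compose[OF calm_at_tendsto] by blast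
      qed
      ultimately have "\<forall>\<^sub>F n in sequentially. dist (h (x (r (s n)))) l < e"
        using e(1) by (simp add: tendsto_iff)
      then show False using r(2) by simp
    qed
    then show ?thesis by (auto simp: convergent_def)
  qed
  ultimately show "(\<forall>p. cluster_point x p \<longrightarrow> p \<in> crit X D) \<and> convergent (\<lambda>k. h (x k))" by blast
qed

theorem proposition4p4:
  fixes X :: "(real^'n) set" and \<tau> \<alpha> :: real
  assumes "closed X" and "convex X" and "0 < \<tau>" and "0 < \<alpha>"
  shows "(\<forall>k g y. \<forall>x\<in>X. \<forall>\<eta>\<in>{0..1}. Phi_S X \<tau> \<alpha> k g x y \<eta> \<subseteq> X \<times> UNIV) \<and>
         (\<forall>\<eta>max. embeddable X {0..\<eta>max} (Phi_S X \<tau> \<alpha>)) \<and>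
         (bounded X \<longrightarrow> embeddable X {0..} (Phi_S X \<tau> \<alpha>))"
proof (intro conjI allI ballI impI)
  fix k g x y and \<eta> :: real assume x: "x \<in> X" and \<eta>: "\<eta> \<in> {0..1}"
  have "prox X u \<in> X" for u
    using closest_point_in_set[OF assms(1)] prox_eq_closest_point[OF assms(1,2)] x by (metis empty_iff)
  then show "Phi_S X \<tau> \<alpha> k g x y \<eta> \<subseteq> X \<times> UNIV"
    using convexD_alt[OF assms(2) x] \<eta> by (auto simp: Phi_S_def)
qed (use assms embeddable_convergence_Phi_S embeddable_displacement_Phi_S_bounded_steps
      embeddable_displacement_Phi_S_bounded_set in \<open>auto simp: embeddable_def\<close>)

end
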